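(* Let $k$ be an algebraically closed field of characteristic zero and let $R$ be an affine $k$-algebra such that the symmetric algebra $S(\Omega^{(1)}(R/k))$ admits at least one symmetric derivation. Then $\Omega^{(1)}(R/k)$ is a projective $R$-module if and only if $\Omega^{(2)}(R/k)$ is a projective $R$-module.
   Context: An affine $k$-algebra is a finitely generated commutative $k$-algebra with unit. $I_R$ is the kernel of the multiplication map $R\otimes_kR\to R$; $\Omega^{(q)}(R/k)=I_R/I_R^{q+1}$ with canonical $q$-th order derivation $\delta^{(q)}(r)=1\otimes r-r\otimes1\bmod I_R^{q+1}$. $S(\Omega^{(1)}(R/k))=\bigoplus_{p\ge0}S^p(\Omega^{(1)}(R/k))$ is the symmetric algebra over $R$, with $S^0=R$. A symmetric derivation is a $k$-linear map $D:S(\Omega^{(1)}(R/k))\to S(\Omega^{(1)}(R/k))$ such that (i) $D(S^p(\Omega^{(1)}(R/k)))\subset S^{p+1}(\Omega^{(1)}(R/k))$ for all $p$, (ii) $D$ is a first order derivation over $k$, and (iii) the restriction of $D$ to $R=S^0(\Omega^{(1)}(R/k))$ is $\delta^{(1)}:R\to\Omega^{(1)}(R/k)$. *)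

theory Defs
  imports "HOL-Computational_Algebra.Polynomial" "HOL-Library.Poly_Mapping"
begin

text \<open>The ground field k is a type 'k; the algebra R is a type 'r (a commutative ring
with unit) together with its structure map alg : k -> R, which must be a unital ring
homomorphism.  The k-action on R is c.r = alg c * r.\<close>

definition k_algebra_map :: "('k::field \<Rightarrow> 'r::comm_ring_1) \<Rightarrow> bool" where
  "k_algebra_map alg \<longleftrightarrow> alg 1 = 1 \<and> (\<forall>a b. alg (a + b) = alg a + alg b)
     \<and> (\<forall>a b. alg (a * b) = alg a * alg b)"

inductive_set k_subalg :: "('k::field \<Rightarrow> 'r::comm_ring_1) \<Rightarrow> 'r set \<Rightarrow> 'r set"
  for alg G where
  gen: "g \<in> G \<Longrightarrow> g \<in> k_subalg alg G"
| scal: "alg c \<in> k_subalg alg G"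
| add: "x \<in> k_subalg alg G \<Longrightarrow> y \<in> k_subalg alg G \<Longrightarrow> x + y \<in> k_subalg alg G"
| mult: "x \<in> k_subalg alg G \<Longrightarrow> y \<in> k_subalg alg G \<Longrightarrow> x * y \<in> k_subalg alg G"

definition affine_k_algebra :: "('k::field \<Rightarrow> 'r::comm_ring_1) \<Rightarrow> bool" where
  "affine_k_algebra alg \<longleftrightarrow> k_algebra_map alg \<and> (\<exists>G. finite G \<and> k_subalg alg G = UNIV)"

definition ksmul :: "'k::field \<Rightarrow> ('a \<Rightarrow>\<^sub>0 'k) \<Rightarrow> ('a \<Rightarrow>\<^sub>0 'k)" where
  "ksmul c x = Poly_Mapping.map ((*) c) x"

inductive_set kspan :: "('a \<Rightarrow>\<^sub>0 'k::field) set \<Rightarrow> ('a \<Rightarrow>\<^sub>0 'k) set" for S where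
  zero: "0 \<in> kspan S"
| step: "s \<in> S \<Longrightarrow> x \<in> kspan S \<Longrightarrow> ksmul c s + x \<in> kspan S"

text \<open>The free k-vector space on R x R; its element tbasis a b stands for the pure
tensor a \<otimes> b.  R \<otimes>_k R is its quotient by the k-span of the bilinearity relations.\<close>
definition tbasis :: "'r \<Rightarrow> 'r \<Rightarrow> ('r \<times> 'r) \<Rightarrow>\<^sub>0 'k::field" where
  "tbasis a b = Poly_Mapping.single (a, b) 1"

definition tensor_relations :: "('k::field \<Rightarrow> 'r::comm_ring_1) \<Rightarrow> (('r \<times> 'r) \<Rightarrow>\<^sub>0 'k) set" where
  "tensor_relations alg =
     {tbasis (a + a') b - tbasis a b - tbasis a' b | a a' b. True}
   \<union> {tbasis a (b + b') - tbasis a b - tbasis a b' | a b b'. True}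
   \<union> {tbasis (alg c * a) b - ksmul c (tbasis a b) | c a b. True}
   \<union> {tbasis a (alg c * b) - ksmul c (tbasis a b) | c a b. True}"

definition tensor_kernel :: "('k::field \<Rightarrow> 'r::comm_ring_1) \<Rightarrow> (('r \<times> 'r) \<Rightarrow>\<^sub>0 'k) set" where
  "tensor_kernel alg = kspan (tensor_relations alg)"

definition tmul :: "(('r::comm_ring_1 \<times> 'r) \<Rightarrow>\<^sub>0 'k::field) \<Rightarrow> (('r \<times> 'r) \<Rightarrow>\<^sub>0 'k) \<Rightarrow> (('r \<times> 'r) \<Rightarrow>\<^sub>0 'k)" where
  "tmul x y = (\<Sum>p\<in>Poly_Mapping.keys x. \<Sum>q\<in>Poly_Mapping.keys y.
      Poly_Mapping.single (fst p * fst q, snd p * snd q) (Poly_Mapping.lookup x p * Poly_Mapping.lookup y q))"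

definition mult_map :: "('k::field \<Rightarrow> 'r::comm_ring_1) \<Rightarrow> (('r \<times> 'r) \<Rightarrow>\<^sub>0 'k) \<Rightarrow> 'r" where
  "mult_map alg x = (\<Sum>p\<in>Poly_Mapping.keys x. alg (Poly_Mapping.lookup x p) * fst p * snd p)"

text \<open>Preimage of I_R (the kernel of the multiplication map) in the free vector space.\<close>
definition IR_pre :: "('k::field \<Rightarrow> 'r::comm_ring_1) \<Rightarrow> (('r \<times> 'r) \<Rightarrow>\<^sub>0 'k) set" where
  "IR_pre alg = {x. mult_map alg x = 0}"

fun tprods :: "(('r::comm_ring_1 \<times> 'r) \<Rightarrow>\<^sub>0 'k::field) set \<Rightarrow> nat \<Rightarrow> (('r \<times> 'r) \<Rightarrow>\<^sub>0 'k) set" where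
  "tprods J 0 = {tbasis 1 1}"
| "tprods J (Suc n) = {tmul x y | x y. x \<in> J \<and> y \<in> tprods J n}"

text \<open>Preimage of the ideal power I_R^n in the free vector space: representatives of
finite sums of n-fold products of elements of I_R.\<close>
definition IR_pow_pre :: "('k::field \<Rightarrow> 'r::comm_ring_1) \<Rightarrow> nat \<Rightarrow> (('r \<times> 'r) \<Rightarrow>\<^sub>0 'k) set" where
  "IR_pow_pre alg n =
     {x. \<exists>y \<in> kspan (tprods (IR_pre alg) n). x - y \<in> tensor_kernel alg}"

text \<open>R acts on R \<otimes>_k R (hence on \<Omega>^(q)) through the left factor: r.x = (r \<otimes> 1) x.\<close>
definition tact :: "'r::comm_ring_1 \<Rightarrow> (('r \<times> 'r) \<Rightarrow>\<^sub>0 'k::field) \<Rightarrow> (('r \<times> 'r) \<Rightarrow>\<^sub>0 'k)" where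
  "tact r x = tmul (tbasis r 1) x"

text \<open>A module presented as M/Q, with M a subgroup of an abelian group 'm, Q a subgroup
of M and act an R-action on M preserving Q.  It is projective iff it is (isomorphic to)
a direct summand of a free R-module, i.e. there are R-linear maps s : M/Q -> F and
p : F -> M/Q with p o s = id, where F is the free R-module on an index set I
(finitely supported functions I -> R).\<close>
definition free_rmul :: "'r::comm_ring_1 \<Rightarrow> ('i \<Rightarrow>\<^sub>0 'r) \<Rightarrow> ('i \<Rightarrow>\<^sub>0 'r)" where
  "free_rmul r f = Poly_Mapping.map ((*) r) f"

definition projective_quot ::
  "'m::ab_group_add set \<Rightarrow> 'm set \<Rightarrow> ('r::comm_ring_1 \<Rightarrow> 'm \<Rightarrow> 'm) \<Rightarrow> bool" where
  "projective_quot M Q act \<longleftrightarrow>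
    (\<exists>(I::'m set) (s::'m \<Rightarrow> ('m \<Rightarrow>\<^sub>0 'r)) p.
       (\<forall>x\<in>M. Poly_Mapping.keys (s x) \<subseteq> I) \<and>
       (\<forall>x\<in>M. \<forall>y\<in>M. x - y \<in> Q \<longrightarrow> s x = s y) \<and>
       (\<forall>x\<in>M. \<forall>y\<in>M. s (x + y) = s x + s y) \<and>
       (\<forall>r. \<forall>x\<in>M. s (act r x) = free_rmul r (s x)) \<and>
       (\<forall>f. Poly_Mapping.keys f \<subseteq> I \<longrightarrow> p f \<in> M) \<and>
       (\<forall>f g. Poly_Mapping.keys f \<subseteq> I \<longrightarrow> Poly_Mapping.keys g \<subseteq> I \<longrightarrow> p (f + g) - (p f + p g) \<in> Q) \<and>
       (\<forall>r f. Poly_Mapping.keys f \<subseteq> I \<longrightarrow> p (free_rmul r f) - act r (p f) \<in> Q) \<and>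
       (\<forall>x\<in>M. p (s x) - x \<in> Q))"

text \<open>\<Omega>^(q)(R/k) = I_R / I_R^(q+1), presented on representatives as IR_pre modulo
IR_pow_pre (q+1) (which contains the tensor kernel), with the left R-action.\<close>
definition Omega_projective :: "('k::field \<Rightarrow> 'r::comm_ring_1) \<Rightarrow> nat \<Rightarrow> bool" where
  "Omega_projective alg q \<longleftrightarrow>
     projective_quot (IR_pre alg) (IR_pow_pre alg (Suc q)) (tact :: 'r \<Rightarrow> _ \<Rightarrow> (('r \<times> 'r) \<Rightarrow>\<^sub>0 'k))"

definition delta_rep :: "'r::comm_ring_1 \<Rightarrow> (('r \<times> 'r) \<Rightarrow>\<^sub>0 'k::field)" where
  "delta_rep r = tbasis 1 r - tbasis r 1"

text \<open>For a module M/Q as above, S(M/Q) is the polynomial ring over R in variables X_v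
(v ranging over 'm) modulo the ideal generated by the linear relations of M/Q
(and X_v for v outside M).  Polynomials in arbitrarily many variables are
finitely supported maps from monomials ('m =>0 nat) to R.  S^p is the image of the
homogeneous polynomials of degree p; S^0 = R (constants), S^1 = M/Q (via X).\<close>

definition Pconst :: "'r::comm_ring_1 \<Rightarrow> (('v \<Rightarrow>\<^sub>0 nat) \<Rightarrow>\<^sub>0 'r)" where
  "Pconst r = Poly_Mapping.single 0 r"

definition Xvar :: "'v \<Rightarrow> (('v \<Rightarrow>\<^sub>0 nat) \<Rightarrow>\<^sub>0 'r::comm_ring_1)" where
  "Xvar v = Poly_Mapping.single (Poly_Mapping.single v 1) 1"

inductive_set ideal_gen :: "'a::comm_ring_1 set \<Rightarrow> 'a set" for G where
  zero: "0 \<in> ideal_gen G"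
| step: "g \<in> G \<Longrightarrow> x \<in> ideal_gen G \<Longrightarrow> a * g + x \<in> ideal_gen G"

definition sym_relations ::
  "'m::ab_group_add set \<Rightarrow> 'm set \<Rightarrow> ('r::comm_ring_1 \<Rightarrow> 'm \<Rightarrow> 'm) \<Rightarrow> (('m \<Rightarrow>\<^sub>0 nat) \<Rightarrow>\<^sub>0 'r) set" where
  "sym_relations M Q act =
      {Xvar (x + y) - Xvar x - Xvar y | x y. x \<in> M \<and> y \<in> M}
    \<union> {Xvar (act r x) - Pconst r * Xvar x | r x. x \<in> M}
    \<union> {Xvar q | q. q \<in> Q}
    \<union> {Xvar v | v. v \<notin> M}"

definition sym_ideal ::
  "'m::ab_group_add set \<Rightarrow> 'm set \<Rightarrow> ('r::comm_ring_1 \<Rightarrow> 'm \<Rightarrow> 'm) \<Rightarrow> (('m \<Rightarrow>\<^sub>0 nat) \<Rightarrow>\<^sub>0 'r) set" where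
  "sym_ideal M Q act = ideal_gen (sym_relations M Q act)"

definition mdeg :: "('v \<Rightarrow>\<^sub>0 nat) \<Rightarrow> nat" where
  "mdeg m = (\<Sum>v\<in>Poly_Mapping.keys m. Poly_Mapping.lookup m v)"

definition homogeneous :: "nat \<Rightarrow> (('v \<Rightarrow>\<^sub>0 nat) \<Rightarrow>\<^sub>0 'r::comm_ring_1) \<Rightarrow> bool" where
  "homogeneous p f \<longleftrightarrow> (\<forall>m\<in>Poly_Mapping.keys f. mdeg m = p)"

type_synonym ('k, 'r) sym_omega1 = "(((('r \<times> 'r) \<Rightarrow>\<^sub>0 'k) \<Rightarrow>\<^sub>0 nat) \<Rightarrow>\<^sub>0 'r)"

text \<open>A map D on S(\<Omega>^(1)(R/k)) is given by a map on representatives respecting the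
defining ideal L.  It is a symmetric derivation iff it is k-linear, maps S^p into
S^(p+1), is a (first order) derivation over k (Leibniz rule), and restricts to
\<delta>^(1) on R = S^0.\<close>
definition symmetric_derivation ::
  "('k::field \<Rightarrow> 'r::comm_ring_1) \<Rightarrow> (('k, 'r) sym_omega1 \<Rightarrow> ('k, 'r) sym_omega1) \<Rightarrow> bool" where
  "symmetric_derivation alg D \<longleftrightarrow>
    (let L = sym_ideal (IR_pre alg) (IR_pow_pre alg 2) (tact :: 'r \<Rightarrow> _ \<Rightarrow> (('r \<times> 'r) \<Rightarrow>\<^sub>0 'k)) in
       (\<forall>f g. f - g \<in> L \<longrightarrow> D f - D g \<in> L) \<and>
       (\<forall>c f g. D (Pconst (alg c) * f + g) - (Pconst (alg c) * D f + D g) \<in> L) \<and>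
       (\<forall>p f. homogeneous p f \<longrightarrow> (\<exists>h. homogeneous (Suc p) h \<and> D f - h \<in> L)) \<and>
       (\<forall>f g. D (f * g) - (f * D g + g * D f) \<in> L) \<and>
       (\<forall>r. D (Pconst r) - Xvar (delta_rep r :: ('r \<times> 'r) \<Rightarrow>\<^sub>0 'k) \<in> L))"

end

(* Let I = I_R and let D be a symmetric derivation. Since D is a derivation, the maps
   a (x) b |-> a D^n(b) / n! for n = 0, 1, 2 are the first three coefficients of a ring homomorphism
   exp(tD) from R (x) R to power series over S(Omega^(1)). The constant coefficient is the
   multiplication map, so it vanishes on I, and the linear one is the quotient map I -> Omega^(1).
   Hence the quadratic coefficient kills I^3 and sends a product uv with u, v in I to the product
   of their classes in S^2(Omega^(1)): it splits the surjection S^2(Omega^(1)) -> I^2/I^3. So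
   Omega^(2) is the direct sum of Omega^(1) and S^2(Omega^(1)), and the latter is projective when
   Omega^(1) is. *)

theory Submission
  imports Defs
begin

text \<open>The quotients in play, \<open>R \<otimes> R\<close>, Omega^(q) and the symmetric
  algebra, depend on \<open>alg\<close> and are given by representatives, so many maps below are
  linear or multiplicative only modulo an ideal, and an identity in a quotient becomes a congruence.
  S^2(Omega^(1)) is never formed as a module. Both directions share a map \<open>e\<close> from
  representatives of \<open>R \<otimes> R\<close> to themselves: the quadratic Taylor coefficient
  followed by multiplication S^2(Omega^(1)) -> I^2/I^3. It is left R-linear modulo I^3 and induces
  the identity on I^2/I^3; hence id - e kills I^2 modulo I^3 and lifts Omega^(1) into Omega^(2),
  which makes Omega^(1) a summand. For the other implication a quadratic polynomial must become an
  element of a free module: a coordinate map from Omega^(1) to a free module F induces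
  S^2(Omega^(1)) -> S^2(F), and S^2(F) is free on the monomials of degree two. The characteristic
  enters through the constant \<open>half\<close>, the coefficient 1/2! of the expansion.\<close>

section \<open>Finitely supported sums and congruence modulo a subgroup\<close>

lemma poly_mapping_additive_induct_keys [consumes 1, case_names zero single add]:
  fixes f :: "'a \<Rightarrow>\<^sub>0 'b::comm_monoid_add"
  assumes "Poly_Mapping.keys f \<subseteq> I" "P 0" "\<And>k a. k \<in> I \<Longrightarrow> P (Poly_Mapping.single k a)"
    and add: "\<And>f g. Poly_Mapping.keys f \<subseteq> I \<Longrightarrow> Poly_Mapping.keys g \<subseteq> I \<Longrightarrow> P f \<Longrightarrow> P g \<Longrightarrow> P (f + g)"
  shows "P f"
proof -
  let ?f = "\<lambda>A. \<Sum>k\<in>A. Poly_Mapping.single k (Poly_Mapping.lookup f k)"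
  have eq: "f = ?f (Poly_Mapping.keys f)"
    by (rule poly_mapping_eqI)
       (auto simp: lookup_sum lookup_single when_def in_keys_iff sum.delta)
  have "P (?f A) \<and> Poly_Mapping.keys (?f A) \<subseteq> I" if "finite A" "A \<subseteq> I" for A
    using that
  proof induction
    case (insert k A)
    then have "Poly_Mapping.keys (Poly_Mapping.single k (Poly_Mapping.lookup f k)) \<subseteq> I"
      by simp
    then show ?case using insert assms(3)[of k] add keys_add by (fastforce simp: subset_iff)
  qed (simp add: assms)
  then show ?thesis using assms(1) by (subst eq) simp
qed

lemmas poly_mapping_additive_induct [case_names zero single add] =
  poly_mapping_additive_induct_keys[where I = UNIV, simplified]

text \<open>\<open>T k\<close> is an arbitrary function of the coefficient: the summands used below,
  such as \<open>tb r 1 * i\<close> as a function of \<open>r\<close>, are additive in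
  \<open>r\<close> only modulo a subgroup.\<close>

definition psum :: "('a \<Rightarrow> 'b::zero \<Rightarrow> 'c::comm_monoid_add) \<Rightarrow> ('a \<Rightarrow>\<^sub>0 'b) \<Rightarrow> 'c" where
  "psum T f = (\<Sum>k\<in>Poly_Mapping.keys f. T k (Poly_Mapping.lookup f k))"

lemma psum_0 [simp]: "psum T 0 = 0"
  by (simp add: psum_def)

locale add_subgroup =
  fixes Z :: "'a::ab_group_add set"
  assumes zero_mem: "0 \<in> Z" and diff_mem: "x \<in> Z \<Longrightarrow> y \<in> Z \<Longrightarrow> x - y \<in> Z"
begin

lemma minus_mem: "x \<in> Z \<Longrightarrow> - x \<in> Z"
  using diff_mem[OF zero_mem] by fastforce

lemma add_mem: "x \<in> Z \<Longrightarrow> y \<in> Z \<Longrightarrow> x + y \<in> Z"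
  using diff_mem[of x "- y"] minus_mem by fastforce

lemma sum_mem: "(\<And>i. i \<in> A \<Longrightarrow> f i \<in> Z) \<Longrightarrow> sum f A \<in> Z"
  by (induction A rule: infinite_finite_induct) (auto intro: add_mem zero_mem)

definition cg :: "'a \<Rightarrow> 'a \<Rightarrow> bool" where "cg x y \<longleftrightarrow> x - y \<in> Z"

lemma cg_refl [simp, intro]: "cg x x" by (simp add: cg_def zero_mem)
lemma cg_sym: "cg x y \<Longrightarrow> cg y x" using minus_mem unfolding cg_def by fastforce
lemma cg_trans [trans]: "cg x y \<Longrightarrow> cg y z \<Longrightarrow> cg x z"
  unfolding cg_def using add_mem by fastforce
lemma cg_add: "cg x x' \<Longrightarrow> cg y y' \<Longrightarrow> cg (x + y) (x' + y')"
  unfolding cg_def using add_mem by (metis add_diff_add)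
lemma cg_diff: "cg x x' \<Longrightarrow> cg y y' \<Longrightarrow> cg (x - y) (x' - y')"
  unfolding cg_def using diff_mem[of "x - x'" "y - y'"] by (simp add: algebra_simps)
lemma cg_0_iff: "cg x 0 \<longleftrightarrow> x \<in> Z" by (simp add: cg_def)
lemma cg_mem: "cg x y \<Longrightarrow> x \<in> Z \<longleftrightarrow> y \<in> Z"
  using cg_0_iff cg_sym cg_trans by blast
lemma cg_sum: "(\<And>i. i \<in> A \<Longrightarrow> cg (f i) (g i)) \<Longrightarrow> cg (sum f A) (sum g A)"
  by (induction A rule: infinite_finite_induct) (auto intro: cg_add)

lemma cg_additive_0:
  assumes "\<And>a b. cg (F (a + b)) (F a + F b)"
  shows "cg (F (0::'b::ab_group_add)) 0"
  using assms[of 0 0] minus_mem unfolding cg_def by fastforce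

lemma psum_superset:
  assumes "finite S" "Poly_Mapping.keys f \<subseteq> S" "\<And>k. cg (T k 0) 0"
  shows "cg (psum T f) (\<Sum>k\<in>S. T k (Poly_Mapping.lookup f k))"
proof -
  have "(\<Sum>k\<in>S. T k (Poly_Mapping.lookup f k))
      = psum T f + (\<Sum>k\<in>S - Poly_Mapping.keys f. T k (Poly_Mapping.lookup f k))"
    using sum.subset_diff[OF assms(2,1)] by (simp add: psum_def add.commute)
  moreover have "(\<Sum>k\<in>S - Poly_Mapping.keys f. T k (Poly_Mapping.lookup f k)) \<in> Z"
    by (rule sum_mem) (use assms(3) in \<open>auto simp: in_keys_iff cg_0_iff\<close>)
  ultimately show ?thesis unfolding cg_def using minus_mem by simp
qed

lemma cg_psum_add:
  assumes "\<And>k. cg (T k 0) 0" "\<And>k a b. cg (T k (a + b)) (T k a + T k b)"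
  shows "cg (psum T (f + g)) (psum T f + psum T g)"
proof -
  let ?S = "Poly_Mapping.keys f \<union> Poly_Mapping.keys g"
  have "cg (psum T (f + g)) (\<Sum>k\<in>?S. T k (Poly_Mapping.lookup (f + g) k))"
    by (rule psum_superset) (simp_all add: keys_add assms)
  also have "cg \<dots> (\<Sum>k\<in>?S. T k (Poly_Mapping.lookup f k) + T k (Poly_Mapping.lookup g k))"
    by (rule cg_sum) (simp add: lookup_add assms)
  also have "\<dots> = (\<Sum>k\<in>?S. T k (Poly_Mapping.lookup f k)) + (\<Sum>k\<in>?S. T k (Poly_Mapping.lookup g k))"
    by (rule sum.distrib)
  also have "cg \<dots> (psum T f + psum T g)"
    by (intro cg_add cg_sym[OF psum_superset] assms) auto
  finally show ?thesis .
qed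

lemma cg_psum_single:
  assumes "cg (T k 0) 0"
  shows "cg (psum T (Poly_Mapping.single k a)) (T k a)"
  using assms cg_sym by (cases "a = 0") (auto simp: psum_def)

lemma psum_mem:
  "(\<And>k a. k \<in> Poly_Mapping.keys f \<Longrightarrow> T k a \<in> Z) \<Longrightarrow> psum T f \<in> Z"
  unfolding psum_def by (rule sum_mem)

text \<open>Agreement on single terms suffices; the value at 0 takes care of itself, because
  additivity modulo \<open>Z\<close> forces it into \<open>Z\<close>.\<close>

lemma additive_ext:
  fixes F G :: "('b \<Rightarrow>\<^sub>0 'c::ab_group_add) \<Rightarrow> 'a"
  assumes F: "\<And>f g. cg (F (f + g)) (F f + F g)" and G: "\<And>f g. cg (G (f + g)) (G f + G g)"
    and "\<And>k a. cg (F (Poly_Mapping.single k a)) (G (Poly_Mapping.single k a))"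
  shows "cg (F f) (G f)"
proof (induction f rule: poly_mapping_additive_induct)
  case zero
  then show ?case using cg_additive_0[of F, OF F] cg_additive_0[of G, OF G] cg_sym cg_trans by blast
next
  case (single k a) then show ?case by (rule assms(3))
next
  case (add f g)
  then show ?case using F G cg_add cg_sym cg_trans by meson
qed

end

lemma add_subgroup_0: "add_subgroup {0}"
  by unfold_locales auto

lemma cg_0_eq: "add_subgroup.cg {0} = (=)"
  by (intro ext) (simp add: add_subgroup.cg_def[OF add_subgroup_0])

text \<open>For the zero subgroup congruence is equality, so the exact versions of the lemmas come
  from the same proofs.\<close>

interpretation triv: add_subgroup "{0}"
  rewrites "add_subgroup.cg {0} = (=)"
  by (rule add_subgroup_0, rule cg_0_eq)

lemmas psum_add = triv.cg_psum_add and psum_single = triv.cg_psum_single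
  and psum_ext = triv.additive_ext

locale ring_ideal = add_subgroup Z for Z :: "'a::comm_ring_1 set" +
  assumes mult_mem: "x \<in> Z \<Longrightarrow> a * x \<in> Z"
begin

lemma mult_mem': "x \<in> Z \<Longrightarrow> x * a \<in> Z"
  using mult_mem by (metis mult.commute)

lemma cg_mult_left: "cg x y \<Longrightarrow> cg (a * x) (a * y)"
  unfolding cg_def using mult_mem by (metis right_diff_distrib)

lemma cg_mult: "cg x x' \<Longrightarrow> cg y y' \<Longrightarrow> cg (x * y) (x' * y')"
  by (metis cg_mult_left cg_trans mult.commute)

end

lemma ring_ideal_0: "ring_ideal {0}"
  by unfold_locales auto

section \<open>The tensor square as a ring\<close>

text \<open>\<^term>\<open>tmul\<close> is an exact commutative ring multiplication on representatives, but
  \<^typ>\<open>('r \<times> 'r) \<Rightarrow>\<^sub>0 'k\<close> already carries a convolution product for the additive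
  structure of the index type; hence the type copy.\<close>

typedef (overloaded) ('r, 'k::zero) tens = "UNIV :: ('r \<times> 'r \<Rightarrow>\<^sub>0 'k) set"
  morphisms rep_tens abs_tens by simp

declare rep_tens_inverse [simp] abs_tens_inverse [simplified, simp]

lemma tmul_psum: "tmul x y = psum (\<lambda>p a. psum (\<lambda>q b.
    Poly_Mapping.single (fst p * fst q, snd p * snd q) (a * b)) y) x"
  by (simp add: tmul_def psum_def)

lemma tmul_single [simp]:
  "tmul (Poly_Mapping.single p a) (Poly_Mapping.single q b)
    = Poly_Mapping.single (fst p * fst q, snd p * snd q) (a * b)"
  unfolding tmul_psum by (subst psum_single; (subst psum_single)?; simp add: psum_def)

lemma tmul_add_right: "tmul x (y + z) = tmul x y + tmul x z"
  unfolding tmul_psum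
  by (subst psum_add) (auto simp: psum_def[of _ x] sum.distrib single_add distrib_left)

lemma tmul_add_left: "tmul (x + y) z = tmul x z + tmul y z"
  unfolding tmul_psum
  by (rule psum_add) (auto simp: psum_def sum.distrib single_add distrib_right)

lemma tmul_commute: "tmul x y = tmul y x"
proof (rule psum_ext[of "\<lambda>x. tmul x y"])
  fix p :: "'a \<times> 'a" and a :: 'b
  show "tmul (Poly_Mapping.single p a) y = tmul y (Poly_Mapping.single p a)"
    by (rule psum_ext[of "\<lambda>y. tmul _ y"]) (simp_all add: tmul_add_left tmul_add_right mult.commute)
qed (simp_all add: tmul_add_left tmul_add_right)

lemma tmul_assoc: "tmul (tmul x y) z = tmul x (tmul y z)"
proof (rule psum_ext[of "\<lambda>x. tmul (tmul x y) z"])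
  fix p :: "'a \<times> 'a" and a :: 'b
  let ?s = "Poly_Mapping.single p a"
  show "tmul (tmul ?s y) z = tmul ?s (tmul y z)"
  proof (rule psum_ext[of "\<lambda>y. tmul (tmul ?s y) z"])
    fix q :: "'a \<times> 'a" and b :: 'b
    let ?t = "Poly_Mapping.single q b"
    show "tmul (tmul ?s ?t) z = tmul ?s (tmul ?t z)"
      by (rule psum_ext[of "\<lambda>z. tmul (tmul ?s ?t) z"])
         (simp_all add: tmul_add_left tmul_add_right mult.assoc)
  qed (simp_all add: tmul_add_left tmul_add_right)
qed (simp_all add: tmul_add_left tmul_add_right)

lemma tmul_1: "tmul (tbasis 1 1) x = x"
  unfolding tbasis_def
  by (rule psum_ext[of "\<lambda>x. tmul _ x"]) (simp_all add: tmul_add_right)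

lemma tmul_0: "tmul 0 x = 0"
  by (simp add: tmul_psum)

text \<open>This ring is the monoid algebra, over the ground field, of the multiplicative monoid of
  pairs from \<open>R\<close>; the tensor square is its quotient by the ideal \<open>K\<close>
  below.\<close>

instantiation tens :: (comm_ring_1, field) comm_ring_1
begin
definition "0 = abs_tens 0"
definition "1 = abs_tens (tbasis 1 1)"
definition "x + y = abs_tens (rep_tens x + rep_tens y)"
definition "x - y = abs_tens (rep_tens x - rep_tens y)"
definition "- x = abs_tens (- rep_tens x)"
definition "x * y = abs_tens (tmul (rep_tens x) (rep_tens y))"
lemmas tens_ops = zero_tens_def one_tens_def plus_tens_def minus_tens_def uminus_tens_def times_tens_def
instance
proof
  show "(0::('a,'b) tens) \<noteq> 1"
    by (metis abs_tens_inverse UNIV_I tbasis_def zero_tens_def one_tens_def lookup_single_eq lookup_zero zero_neq_one)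
qed (simp_all add: tens_ops tmul_add_left tmul_assoc tmul_1 add.assoc,
     simp_all add: add.commute tmul_commute)
end

lemma rep_simps [simp]:
  "rep_tens 0 = 0" "rep_tens 1 = tbasis 1 1" "rep_tens (x + y) = rep_tens x + rep_tens y" "rep_tens (x - y) = rep_tens x - rep_tens y"
  "rep_tens (- x) = - rep_tens x" "rep_tens (x * y) = tmul (rep_tens x) (rep_tens y)"
  by (simp_all add: tens_ops)

lemma abs_simps:
  "abs_tens 0 = 0" "abs_tens (x + y) = abs_tens x + abs_tens y" "abs_tens (x - y) = abs_tens x - abs_tens y"
  "abs_tens (- x) = - abs_tens x" "abs_tens (tmul x y) = abs_tens x * abs_tens y"
  by (simp_all add: tens_ops)

definition tb :: "'r \<Rightarrow> 'r \<Rightarrow> ('r::comm_ring_1, 'k::field) tens" where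
  "tb a b = abs_tens (tbasis a b)"

text \<open>The scalar stays a coefficient and is not moved into \<open>R\<close>:
  \<open>sc k\<close> and \<open>tb (alg k) 1\<close> are different elements that agree only modulo
  \<open>K\<close>.\<close>

definition sc :: "'k \<Rightarrow> ('r::comm_ring_1, 'k::field) tens" where
  "sc k = abs_tens (Poly_Mapping.single (1, 1) k)"

lemma rep_tb [simp]: "rep_tens (tb a b) = tbasis a b"
  and rep_sc [simp]: "rep_tens (sc k) = Poly_Mapping.single (1, 1) k"
  by (simp_all add: tb_def sc_def)

lemma tb_mult: "tb a b * tb a' b' = tb (a * a') (b * b')"
  by (simp add: tb_def tens_ops tbasis_def)

lemma tb_1: "tb 1 1 = 1"
  by (simp add: tb_def tens_ops)

lemma sc_1 [simp]: "sc 1 = 1"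
  by (simp add: sc_def tens_ops tbasis_def)

lemma sc_mult: "sc (a * b) = sc a * sc b"
  by (simp add: sc_def tens_ops)

lemma abs_single: "abs_tens (Poly_Mapping.single (a, b) k) = sc k * tb a b"
  by (simp add: tb_def sc_def tens_ops tbasis_def)

lemma lookup_ksmul: "Poly_Mapping.lookup (ksmul c x) k = c * Poly_Mapping.lookup x k"
  by (simp add: ksmul_def Poly_Mapping.map.rep_eq when_def)

lemma lookup_free_rmul: "Poly_Mapping.lookup (free_rmul c x) k = c * Poly_Mapping.lookup x k"
  by (simp add: free_rmul_def Poly_Mapping.map.rep_eq when_def)

lemma ksmul_add: "ksmul c (x + y) = ksmul c x + ksmul c y"
  by (rule poly_mapping_eqI) (simp add: lookup_ksmul lookup_add distrib_left)

lemma free_rmul_add: "free_rmul c (x + y) = free_rmul c x + free_rmul c y"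
  by (rule poly_mapping_eqI) (simp add: lookup_free_rmul lookup_add distrib_left)

lemma ksmul_single [simp]: "ksmul c (Poly_Mapping.single k a) = Poly_Mapping.single k (c * a)"
  by (rule poly_mapping_eqI) (simp add: lookup_ksmul lookup_single when_def)

lemma free_rmul_single [simp]:
  "free_rmul c (Poly_Mapping.single k a) = Poly_Mapping.single k (c * a)"
  by (rule poly_mapping_eqI) (simp add: lookup_free_rmul lookup_single when_def)

lemma free_rmul_zero [simp]: "free_rmul c 0 = 0"
  by (rule poly_mapping_eqI) (simp add: lookup_free_rmul)

lemma ksmul_tmul: "ksmul k x = tmul (Poly_Mapping.single (1, 1) k) x"
  by (rule psum_ext[of "ksmul k"]) (simp_all add: ksmul_add tmul_add_right)

lemma abs_ksmul: "abs_tens (ksmul k x) = sc k * abs_tens x"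
  by (simp add: ksmul_tmul sc_def tens_ops)

lemma tact_abs: "tact r x = rep_tens (tb r 1 * abs_tens x)"
  by (simp add: tact_def)

lemma abs_tact: "abs_tens (tact r x) = tb r 1 * abs_tens x"
  by (simp add: tact_abs del: rep_simps)

lemma (in add_subgroup) tens_ext:
  fixes F G :: "('r::comm_ring_1, 'k::field) tens \<Rightarrow> 'a"
  assumes F: "\<And>x y. cg (F (x + y)) (F x + F y)" and G: "\<And>x y. cg (G (x + y)) (G x + G y)"
    and *: "\<And>k a b. cg (F (sc k * tb a b)) (G (sc k * tb a b))"
  shows "cg (F x) (G x)"
proof -
  have "cg ((F \<circ> abs_tens) (rep_tens x)) ((G \<circ> abs_tens) (rep_tens x))"
  proof (rule additive_ext)
    fix p :: "'r \<times> 'r" and k :: 'k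
    show "cg ((F \<circ> abs_tens) (Poly_Mapping.single p k)) ((G \<circ> abs_tens) (Poly_Mapping.single p k))"
      using * by (cases p) (simp add: abs_single)
  qed (simp_all add: abs_simps F G)
  then show ?thesis by simp
qed

lemmas tens_eqI = triv.tens_ext

section \<open>Linear spans over the ground field\<close>

lemma ksmul_1: "ksmul 1 x = x"
  by (rule poly_mapping_eqI) (simp add: lookup_ksmul)

lemma kspan_base: "s \<in> S \<Longrightarrow> s \<in> kspan S"
  using kspan.step[OF _ kspan.zero, of s S 1] by (simp add: ksmul_1)

lemma kspan_add: "x \<in> kspan S \<Longrightarrow> y \<in> kspan S \<Longrightarrow> x + y \<in> kspan S"
  by (induction rule: kspan.induct) (auto simp: add.assoc intro: kspan.step)

lemma ksmul_ksmul: "ksmul a (ksmul b x) = ksmul (a * b) x"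
  by (rule poly_mapping_eqI) (simp add: lookup_ksmul mult.assoc)

lemma ksmul_zero [simp]: "ksmul a 0 = 0"
  by (rule poly_mapping_eqI) (simp add: lookup_ksmul)

lemma ksmul_uminus_1: "ksmul (- 1) x = - x"
  by (rule poly_mapping_eqI) (simp add: lookup_ksmul)

lemma kspan_ksmul: "x \<in> kspan S \<Longrightarrow> ksmul c x \<in> kspan S"
  by (induction rule: kspan.induct) (auto simp: ksmul_add ksmul_ksmul intro: kspan.intros)

lemma kspan_diff: "x \<in> kspan S \<Longrightarrow> y \<in> kspan S \<Longrightarrow> x - y \<in> kspan S"
  using kspan_add[OF _ kspan_ksmul, of x S y "-1"] by (simp add: ksmul_uminus_1)

lemma kspan_least:
  assumes "x \<in> kspan S" "add_subgroup Z" "\<And>s. s \<in> S \<Longrightarrow> s \<in> Z"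
    "\<And>c s. s \<in> Z \<Longrightarrow> ksmul c s \<in> Z"
  shows "x \<in> Z"
  using assms(1) by induction (auto intro: assms add_subgroup.zero_mem add_subgroup.add_mem)

lemma tmul_ksmul: "tmul a (ksmul c x) = ksmul c (tmul a x)"
  by (metis ksmul_tmul tmul_assoc tmul_commute)

lemma kspan_tmul:
  assumes "x \<in> kspan S" "\<And>s. s \<in> S \<Longrightarrow> tmul a s \<in> kspan S"
  shows "tmul a x \<in> kspan S"
  using assms(1)
proof induction
  case zero then show ?case by (simp add: tmul_commute[of a] tmul_0 kspan.zero)
next
  case (step s x c)
  then show ?case
    by (simp add: tmul_add_right tmul_ksmul kspan_add kspan_ksmul assms(2))
qed

section \<open>The powers of the diagonal ideal\<close>

locale kalg =
  fixes alg :: "'k::field \<Rightarrow> 'r::comm_ring_1"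
  assumes alg: "k_algebra_map alg"
begin

lemma alg_1 [simp]: "alg 1 = 1" and alg_add: "alg (a + b) = alg a + alg b"
  and alg_mult: "alg (a * b) = alg a * alg b"
  using alg by (auto simp: k_algebra_map_def)

lemma alg_0 [simp]: "alg 0 = 0"
  using alg_add[of 0 0] by simp

definition mm :: "('r, 'k) tens \<Rightarrow> 'r" where "mm x = mult_map alg (rep_tens x)"

lemma mm_psum: "mm x = psum (\<lambda>p k. alg k * fst p * snd p) (rep_tens x)"
  by (simp add: mm_def mult_map_def psum_def)

lemma mm_add: "mm (x + y) = mm x + mm y"
  unfolding mm_psum rep_simps by (rule psum_add) (auto simp: alg_add distrib_right)

lemma mm_single: "mm (sc k * tb a b) = alg k * a * b"
  unfolding abs_single[symmetric] mm_psum by (simp add: psum_single)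

lemma mm_tb: "mm (tb a b) = a * b"
  using mm_single[of 1] by simp

lemma mm_0: "mm 0 = 0" using mm_add[of 0 0] by simp

lemma mm_diff: "mm (x - y) = mm x - mm y"
  using mm_add[of "x - y" y] by (simp add: algebra_simps)

lemma mm_mult: "mm (x * y) = mm x * mm y"
proof (rule tens_eqI[of "\<lambda>x. mm (x * y)"])
  fix k :: 'k and a b :: 'r
  show "mm (sc k * tb a b * y) = mm (sc k * tb a b) * mm y"
  proof (rule tens_eqI[of "\<lambda>y. mm (_ * y)"])
    fix k' :: 'k and a' b' :: 'r
    have "sc k * tb a b * (sc k' * tb a' b') = sc (k * k') * (tb (a * a') (b * b') :: ('r, 'k) tens)"
      by (simp add: sc_mult tb_mult[symmetric] mult_ac)
    then show "mm (sc k * tb a b * (sc k' * tb a' b')) = mm (sc k * tb a b) * mm (sc k' * tb a' b')"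
      by (simp only: mm_single alg_mult mult_ac)
  qed (simp_all add: mm_add algebra_simps)
qed (simp_all add: mm_add algebra_simps)

text \<open>\<open>J\<close>, \<open>K\<close> and \<open>Q n\<close> are the preimages in
  \<open>tens\<close> of I_R, of 0 and of I_R^n, so Omega^(q) is \<open>J\<close> modulo
  \<open>Q (Suc q)\<close>.\<close>

definition J :: "('r, 'k) tens set" where "J = {x. rep_tens x \<in> IR_pre alg}"
definition K :: "('r, 'k) tens set" where "K = {x. rep_tens x \<in> tensor_kernel alg}"
definition Q :: "nat \<Rightarrow> ('r, 'k) tens set" where "Q n = {x. rep_tens x \<in> IR_pow_pre alg n}"

lemma J_iff: "x \<in> J \<longleftrightarrow> mm x = 0"
  by (simp add: J_def mm_def IR_pre_def)

sublocale J: ring_ideal J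
  by unfold_locales (simp_all add: J_iff mm_0 mm_diff mm_mult)

lemma tb_rel:
  shows "tb (a + a') b - tb a b - tb a' b \<in> K" "tb a (b + b') - tb a b - tb a b' \<in> K"
    "tb (alg c * a) b - sc c * tb a b \<in> K" "tb a (alg c * b) - sc c * tb a b \<in> K"
  unfolding K_def tensor_kernel_def tensor_relations_def mem_Collect_eq rep_simps rep_tb rep_sc
    ksmul_tmul[symmetric]
  by (rule kspan_base, blast)+

lemma tensor_kernel_tmul:
  assumes "x \<in> tensor_kernel alg"
  shows "tmul a x \<in> tensor_kernel alg"
  unfolding tensor_kernel_def
proof (rule kspan_tmul[OF assms[unfolded tensor_kernel_def]])
  fix s :: "'r \<times> 'r \<Rightarrow>\<^sub>0 'k" assume s: "s \<in> tensor_relations alg"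
  \<comment> \<open>Each of the four families of relations is stable under multiplication by a pure
    tensor, since these multiply componentwise; spans are needed only for general
    multipliers.\<close>
  have basis: "tmul (tbasis p q) s \<in> tensor_relations alg" for p q
  proof -
    have tm: "tmul (tbasis p q) (tbasis a b) = (tbasis (p * a) (q * b) :: 'r \<times> 'r \<Rightarrow>\<^sub>0 'k)" for a b
      by (simp add: tbasis_def)
    have tmd: "tmul (tbasis p q) (x - y) = tmul (tbasis p q) x - (tmul (tbasis p q) y :: 'r \<times> 'r \<Rightarrow>\<^sub>0 'k)" for x y
      using tmul_add_right[of "tbasis p q" "x - y" y] by (simp add: algebra_simps)
    have *: "p * (alg c * a) = alg c * (p * a)" for p c a by (simp add: mult_ac)
    show ?thesis
      using s unfolding tensor_relations_def
      apply (elim UnE CollectE exE conjE; simp only: tm tmd tmul_ksmul distrib_left *)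
      by blast+
  qed
  show "tmul a s \<in> kspan (tensor_relations alg)"
  proof (induction a rule: poly_mapping_additive_induct)
    case zero then show ?case by (simp add: tmul_0 kspan.zero)
  next
    case (single p k)
    have "Poly_Mapping.single p k = ksmul k (tbasis (fst p) (snd p))"
      by (simp add: tbasis_def)
    then have "tmul (Poly_Mapping.single p k) s = ksmul k (tmul (tbasis (fst p) (snd p)) s)"
      by (metis ksmul_tmul tmul_assoc)
    then show ?case using basis kspan_base kspan_ksmul by metis
  next
    case (add f g) then show ?case by (simp add: tmul_add_left kspan_add)
  qed
qed

sublocale K: ring_ideal K
  by unfold_locales
    (auto simp: K_def tensor_kernel_tmul, auto simp: tensor_kernel_def intro: kspan.zero kspan_diff)

lemma K_subset_J: "K \<subseteq> J"
proof
  fix x :: "('r, 'k) tens" assume "x \<in> K"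
  then have "rep_tens x \<in> kspan (tensor_relations alg)" by (simp add: K_def tensor_kernel_def)
  then have "abs_tens (rep_tens x) \<in> J"
  proof induction
    case zero then show ?case by (simp add: abs_simps J.zero_mem)
  next
    case (step s x c)
    have "abs_tens s \<in> J"
      using step(1) unfolding tensor_relations_def J_iff
      by (elim UnE CollectE exE conjE)
         (simp_all add: abs_simps abs_ksmul mm_diff mm_single mm_tb distrib_left distrib_right
           mult_ac flip: tb_def)
    then show ?case using step by (simp add: abs_simps abs_ksmul J.mult_mem J.add_mem)
  qed
  then show "x \<in> J" by simp
qed

lemma Q_iff: "x \<in> Q n \<longleftrightarrow> (\<exists>y. rep_tens y \<in> kspan (tprods (IR_pre alg) n) \<and> x - y \<in> K)"
  unfolding Q_def IR_pow_pre_def K_def mem_Collect_eq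
  by (metis rep_simps(4) UNIV_I abs_tens_inverse)

lemma K_subset_Q: "K \<subseteq> Q n"
  unfolding Q_iff subset_iff by (metis kspan.zero rep_simps(1) diff_zero)

text \<open>A positive exponent matters: a multiplier is absorbed by the first factor, which lies in
  the ideal \<open>J\<close>. For exponent 0 the generating set is just the unit, whose span need
  not be an ideal.\<close>

lemma ring_ideal_Q: "ring_ideal (Q (Suc n))"
proof
  show "0 \<in> Q (Suc n)" using K_subset_Q K.zero_mem by blast
next
  fix x y :: "('r, 'k) tens" assume "x \<in> Q (Suc n)" "y \<in> Q (Suc n)"
  then obtain x' y' where *: "rep_tens x' \<in> kspan (tprods (IR_pre alg) (Suc n))" "x - x' \<in> K"
    "rep_tens y' \<in> kspan (tprods (IR_pre alg) (Suc n))" "y - y' \<in> K"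
    unfolding Q_iff by blast
  have "rep_tens (x' - y') \<in> kspan (tprods (IR_pre alg) (Suc n))"
    using * by (simp add: kspan_diff)
  moreover have "(x - y) - (x' - y') \<in> K"
    using K.diff_mem[OF *(2,4)] by (simp add: algebra_simps)
  ultimately show "x - y \<in> Q (Suc n)" unfolding Q_iff by blast
next
  fix x a :: "('r, 'k) tens" assume "x \<in> Q (Suc n)"
  then obtain x' where x': "rep_tens x' \<in> kspan (tprods (IR_pre alg) (Suc n))" "x - x' \<in> K"
    unfolding Q_iff by blast
  have "tmul (rep_tens a) (rep_tens x') \<in> kspan (tprods (IR_pre alg) (Suc n))"
  proof (rule kspan_tmul[OF x'(1)])
    fix s assume "s \<in> tprods (IR_pre alg) (Suc n)"
    then obtain u v where s: "s = tmul u v" "u \<in> IR_pre alg" "v \<in> tprods (IR_pre alg) n" by auto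
    have "abs_tens u \<in> J" using s by (simp add: J_def)
    from J.mult_mem[OF this, of a] have "tmul (rep_tens a) u \<in> IR_pre alg" by (simp add: J_def)
    then show "tmul (rep_tens a) s \<in> kspan (tprods (IR_pre alg) (Suc n))"
      using s by (auto simp: tmul_assoc[symmetric] intro!: kspan_base)
  qed
  moreover have "a * x - a * x' \<in> K"
    using K.mult_mem[OF x'(2), of a] by (simp add: right_diff_distrib)
  ultimately show "a * x \<in> Q (Suc n)" unfolding Q_iff by (metis rep_simps(6))
qed

text \<open>Induction over a power of I. \<open>Z\<close> is only asked to be stable under scalars,
  so that it may be the set where an additive map is congruent to the identity, which need not be
  visibly an ideal.\<close>

lemma Q_least:
  assumes x: "x \<in> Q n" and Z: "add_subgroup Z" "K \<subseteq> Z" "\<And>c y. y \<in> Z \<Longrightarrow> sc c * y \<in> Z"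
    and gen: "\<And>y. rep_tens y \<in> tprods (IR_pre alg) n \<Longrightarrow> y \<in> Z"
  shows "x \<in> Z"
proof -
  interpret add_subgroup Z by fact
  from x obtain y where y: "rep_tens y \<in> kspan (tprods (IR_pre alg) n)" "x - y \<in> K"
    unfolding Q_iff by blast
  have "rep_tens y \<in> {y. abs_tens y \<in> Z}"
  proof (rule kspan_least[OF y(1)])
    show "add_subgroup {y. abs_tens y \<in> Z}"
      by unfold_locales (auto simp: abs_simps zero_mem diff_mem)
  qed (auto simp: gen abs_ksmul Z)
  then have "(x - y) + y \<in> Z" using y Z by (intro add_mem) auto
  then show ?thesis by simp
qed

lemma Q2_least:
  assumes "x \<in> Q 2" "add_subgroup Z" "K \<subseteq> Z" "\<And>c y. y \<in> Z \<Longrightarrow> sc c * y \<in> Z"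
    and gen: "\<And>u v. u \<in> J \<Longrightarrow> v \<in> J \<Longrightarrow> u * v \<in> Z"
  shows "x \<in> Z"
proof (rule Q_least[OF assms(1-4)])
  fix y :: "('r, 'k) tens" assume "rep_tens y \<in> tprods (IR_pre alg) 2"
  then obtain u v where "rep_tens y = tmul u (tmul v (tbasis 1 1))" "u \<in> IR_pre alg" "v \<in> IR_pre alg"
    by (auto simp: numeral_2_eq_2)
  then have "y = abs_tens u * abs_tens v" "abs_tens u \<in> J" "abs_tens v \<in> J"
    by (auto simp: J_def abs_simps tmul_commute[of v] tmul_1 simp flip: abs_simps(5))
       (metis rep_tens_inverse)
  then show "y \<in> Z" using gen by auto
qed

lemma Q3_least:
  assumes "x \<in> Q 3" "add_subgroup Z" "K \<subseteq> Z" "\<And>c y. y \<in> Z \<Longrightarrow> sc c * y \<in> Z"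
    and gen: "\<And>u v w. u \<in> J \<Longrightarrow> v \<in> J \<Longrightarrow> w \<in> J \<Longrightarrow> u * (v * w) \<in> Z"
  shows "x \<in> Z"
proof (rule Q_least[OF assms(1-4)])
  fix y :: "('r, 'k) tens" assume "rep_tens y \<in> tprods (IR_pre alg) 3"
  then obtain u v w where "rep_tens y = tmul u (tmul v (tmul w (tbasis 1 1)))"
    "u \<in> IR_pre alg" "v \<in> IR_pre alg" "w \<in> IR_pre alg"
    by (auto simp: numeral_3_eq_3)
  then have "y = abs_tens u * (abs_tens v * abs_tens w)" "abs_tens u \<in> J" "abs_tens v \<in> J" "abs_tens w \<in> J"
    by (auto simp: J_def abs_simps tmul_commute[of w] tmul_1 simp flip: abs_simps(5))
       (metis rep_tens_inverse)
  then show "y \<in> Z" using gen by auto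
qed

lemma Q2_prod: "u \<in> J \<Longrightarrow> v \<in> J \<Longrightarrow> u * v \<in> Q 2"
proof -
  assume "u \<in> J" "v \<in> J"
  then have "rep_tens (u * (v * 1)) \<in> tprods (IR_pre alg) 2"
    unfolding rep_simps tprods.simps numeral_2_eq_2 J_def by blast
  then show ?thesis unfolding Q_iff using kspan_base K.zero_mem by (metis diff_self mult_1_right)
qed

lemma Q3_prod': "u \<in> J \<Longrightarrow> v \<in> J \<Longrightarrow> w \<in> J \<Longrightarrow> u * (v * w) \<in> Q 3"
proof -
  assume "u \<in> J" "v \<in> J" "w \<in> J"
  then have "rep_tens (u * (v * (w * 1))) \<in> tprods (IR_pre alg) 3"
    unfolding rep_simps tprods.simps numeral_3_eq_3 J_def by blast
  then show ?thesis unfolding Q_iff using kspan_base K.zero_mem by (metis diff_self mult_1_right)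
qed

sublocale Q2: ring_ideal "Q 2"
  using ring_ideal_Q[of 1] by (simp add: numeral_2_eq_2)

sublocale Q3: ring_ideal "Q 3"
  using ring_ideal_Q[of 2] by (simp add: numeral_3_eq_3 numeral_2_eq_2)

lemma Q_subset_J: "Q (Suc n) \<subseteq> J"
proof
  fix x assume "x \<in> Q (Suc n)"
  then show "x \<in> J"
  proof (rule Q_least[OF _ J.add_subgroup_axioms K_subset_J J.mult_mem])
    fix y :: "('r, 'k) tens" assume "rep_tens y \<in> tprods (IR_pre alg) (Suc n)"
    then obtain u v where "rep_tens y = tmul u v" "u \<in> IR_pre alg" by auto
    then have "y = abs_tens u * abs_tens v" "abs_tens u \<in> J"
      by (simp_all add: J_def flip: abs_simps(5)) (metis rep_tens_inverse)
    then show "y \<in> J" using J.mult_mem' by simp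
  qed
qed

lemma Q2_subset_J: "Q 2 \<subseteq> J"
  using Q_subset_J[of 1] by (simp add: numeral_2_eq_2)

lemma Q3_subset_Q2: "Q 3 \<subseteq> Q 2"
  using Q3_least[of _ "Q 2"] K_subset_Q Q2.add_subgroup_axioms Q2.mult_mem Q2_prod by blast

lemma Q3_prod:
  assumes "u \<in> J" "x \<in> Q 2" shows "u * x \<in> Q 3"
proof -
  have "x \<in> {x. u * x \<in> Q 3}"
  proof (rule Q2_least[OF assms(2)])
    show "add_subgroup {x. u * x \<in> Q 3}"
      by unfold_locales (auto simp: Q3.zero_mem Q3.diff_mem right_diff_distrib)
  next
    fix c y assume "y \<in> {x. u * x \<in> Q 3}"
    then show "sc c * y \<in> {x. u * x \<in> Q 3}" using Q3.mult_mem[of "u * y" "sc c"] by (simp add: mult_ac)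
  qed (use assms K.mult_mem K_subset_Q Q3_prod' in blast)+
  then show ?thesis by simp
qed

lemma tb_add_left: "K.cg (tb (a + a') b) (tb a b + tb a' b)"
  using tb_rel(1) by (simp add: K.cg_def diff_diff_eq)

lemma tb_alg: "K.cg (tb (alg k * a) b) (sc k * tb a b)"
  using tb_rel(3) by (simp add: K.cg_def)

lemma K_cg_Q2: "K.cg x y \<Longrightarrow> Q2.cg x y"
  using K_subset_Q by (auto simp: K.cg_def Q2.cg_def)

lemma K_cg_Q3: "K.cg x y \<Longrightarrow> Q3.cg x y"
  using K_subset_Q by (auto simp: K.cg_def Q3.cg_def)

end

section \<open>Degree-two parts of polynomials\<close>

lemma Pconst_add: "Pconst (a + b) = Pconst a + Pconst b"
  by (simp add: Pconst_def single_add)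

lemma Pconst_mult: "Pconst (a * b) = Pconst a * Pconst b"
  by (simp add: Pconst_def mult_single)

lemma Pconst_1 [simp]: "Pconst 1 = 1"
  by (simp add: Pconst_def)

lemma Pconst_0 [simp]: "Pconst 0 = 0"
  by (simp add: Pconst_def)

lemma mdeg_superset:
  "finite S \<Longrightarrow> Poly_Mapping.keys m \<subseteq> S \<Longrightarrow> mdeg m = (\<Sum>v\<in>S. Poly_Mapping.lookup m v)"
  unfolding mdeg_def by (rule sum.mono_neutral_left) (auto simp: in_keys_iff)

lemma mdeg_add: "mdeg (m + n) = mdeg m + mdeg n"
proof -
  let ?S = "Poly_Mapping.keys m \<union> Poly_Mapping.keys n"
  have "Poly_Mapping.keys (m + n) \<subseteq> ?S" by (rule keys_add)
  then show ?thesis by (simp add: mdeg_superset[of ?S] lookup_add sum.distrib)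
qed

lemma mdeg_single [simp]: "mdeg (Poly_Mapping.single v n) = n"
  by (simp add: mdeg_def)

lemma mdeg_1E:
  assumes "mdeg m = 1" obtains w where "m = Poly_Mapping.single w 1"
proof -
  obtain w where w: "w \<in> Poly_Mapping.keys m" "Poly_Mapping.lookup m w = 1"
    "\<forall>b\<in>Poly_Mapping.keys m. w \<noteq> b \<longrightarrow> Poly_Mapping.lookup m b = 0"
    using sum_eq_1_iff[OF finite_keys] assms unfolding mdeg_def by metis
  have "m = Poly_Mapping.single w 1"
    using w by (intro poly_mapping_eqI) (metis in_keys_iff lookup_single_eq lookup_single_not_eq)
  then show thesis by (rule that)
qed

definition mono_val :: "('v \<Rightarrow> 'b::comm_monoid_mult) \<Rightarrow> ('v \<Rightarrow>\<^sub>0 nat) \<Rightarrow> 'b" where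
  "mono_val \<theta> m = (\<Prod>v\<in>Poly_Mapping.keys m. \<theta> v ^ Poly_Mapping.lookup m v)"

lemma mono_val_superset:
  "finite S \<Longrightarrow> Poly_Mapping.keys m \<subseteq> S \<Longrightarrow> mono_val \<theta> m = (\<Prod>v\<in>S. \<theta> v ^ Poly_Mapping.lookup m v)"
  unfolding mono_val_def by (rule prod.mono_neutral_left) (auto simp: in_keys_iff)

lemma mono_val_add: "mono_val \<theta> (m + n) = mono_val \<theta> m * mono_val \<theta> n"
proof -
  let ?S = "Poly_Mapping.keys m \<union> Poly_Mapping.keys n"
  have "Poly_Mapping.keys (m + n) \<subseteq> ?S" by (rule keys_add)
  then show ?thesis by (simp add: mono_val_superset[of ?S] lookup_add power_add prod.distrib)
qed

lemma mono_val_single_1 [simp]: "mono_val \<theta> (Poly_Mapping.single v 1) = \<theta> v"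
  by (simp add: mono_val_def)

lemma mdeg_2E:
  assumes "mdeg m = 2"
  obtains u v where "m = Poly_Mapping.single u 1 + Poly_Mapping.single v 1"
proof -
  have "Poly_Mapping.keys m \<noteq> {}" using assms by (auto simp: mdeg_def)
  then obtain u where u: "Poly_Mapping.lookup m u \<noteq> 0" by (metis all_not_in_conv in_keys_iff)
  define n where "n = m - Poly_Mapping.single u 1"
  have m: "m = Poly_Mapping.single u 1 + n"
    using u by (intro poly_mapping_eqI) (auto simp: n_def lookup_add lookup_minus lookup_single when_def)
  then have "mdeg n = 1" using assms by (simp add: mdeg_add)
  then show thesis using m that mdeg_1E by metis
qed

text \<open>Only the degree-two part is evaluated: the relation \<open>Xvar q\<close> with \<open>q\<close> in \<open>I\<^sup>2\<close> evaluates to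
  an element outside \<open>I\<^sup>3\<close>, whereas its products with elements of \<open>I\<close> lie in \<open>I\<^sup>3\<close>.\<close>

definition deg2_eval :: "('r \<Rightarrow> 'b) \<Rightarrow> ('v \<Rightarrow> 'b) \<Rightarrow> (('v \<Rightarrow>\<^sub>0 nat) \<Rightarrow>\<^sub>0 'r::comm_ring_1) \<Rightarrow> 'b::comm_ring_1" where
  "deg2_eval c \<theta> = psum (\<lambda>m r. if mdeg m = 2 then c r * mono_val \<theta> m else 0)"

text \<open>\<open>c\<close> is the structure map of the target as an R-algebra. It is a
  homomorphism only modulo \<open>Z\<close>, because one of its two uses is \<open>tb r 1\<close>,
  which is additive in \<open>r\<close> only modulo \<open>K\<close>; the other is
  \<open>Pconst\<close>.\<close>

locale deg2 = ring_ideal Z for Z :: "'b::comm_ring_1 set" +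
  fixes c :: "'r::comm_ring_1 \<Rightarrow> 'b" and \<theta> :: "'v::ab_group_add \<Rightarrow> 'b"
  assumes c_add: "cg (c (a + b)) (c a + c b)"
    and c_mult: "cg (c (a * b)) (c a * c b)"
    and c_1: "cg (c 1) 1"
begin

lemma c_0: "cg (c 0) 0"
  by (rule cg_additive_0[OF c_add])

lemma c_0_mult: "cg (c 0 * x) 0"
  using cg_mult[OF c_0, of x x] by simp

lemma c_add_mult: "cg (c (a + b) * x) (c a * x + c b * x)"
  using cg_mult[OF c_add, of x x] by (simp add: distrib_right)

lemma deg2_eval_add: "cg (deg2_eval c \<theta> (f + g)) (deg2_eval c \<theta> f + deg2_eval c \<theta> g)"
  unfolding deg2_eval_def by (rule cg_psum_add) (auto simp: c_0_mult c_add_mult)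

lemma deg2_eval_single:
  "cg (deg2_eval c \<theta> (Poly_Mapping.single m r)) (if mdeg m = 2 then c r * mono_val \<theta> m else 0)"
  unfolding deg2_eval_def by (rule cg_psum_single) (auto simp: c_0_mult)

lemma deg2_eval_Pconst: "cg (deg2_eval c \<theta> (Pconst r * f)) (c r * deg2_eval c \<theta> f)"
proof (rule additive_ext)
  fix m r'
  have "cg (deg2_eval c \<theta> (Pconst r * Poly_Mapping.single m r')) (if mdeg m = 2 then c (r * r') * mono_val \<theta> m else 0)"
    unfolding Pconst_def mult_single using deg2_eval_single by simp
  also have "cg \<dots> (c r * (if mdeg m = 2 then c r' * mono_val \<theta> m else 0))"
    using cg_mult[OF c_mult[of r r'], of "mono_val \<theta> m" "mono_val \<theta> m"] by (simp add: mult.assoc)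
  also have "cg \<dots> (c r * deg2_eval c \<theta> (Poly_Mapping.single m r'))"
    by (intro cg_mult_left cg_sym[OF deg2_eval_single])
  finally show "cg (deg2_eval c \<theta> (Pconst r * Poly_Mapping.single m r'))
    (c r * deg2_eval c \<theta> (Poly_Mapping.single m r'))" .
next
  fix f g
  show "cg (deg2_eval c \<theta> (Pconst r * (f + g))) (deg2_eval c \<theta> (Pconst r * f) + deg2_eval c \<theta> (Pconst r * g))"
    using deg2_eval_add by (simp add: distrib_left)
  show "cg (c r * deg2_eval c \<theta> (f + g)) (c r * deg2_eval c \<theta> f + c r * deg2_eval c \<theta> g)"
    using cg_mult_left[OF deg2_eval_add] by (simp add: distrib_left)
qed

lemma deg2_eval_diff: "cg (deg2_eval c \<theta> (f - g)) (deg2_eval c \<theta> f - deg2_eval c \<theta> g)"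
  using cg_diff[OF cg_sym[OF deg2_eval_add[of "f - g" g]] cg_refl[of "deg2_eval c \<theta> g"]] cg_sym by simp

lemma deg2_eval_single_Xvar:
  "cg (deg2_eval c \<theta> (Poly_Mapping.single m r * Xvar v)) (if mdeg m = 1 then c r * mono_val \<theta> m * \<theta> v else 0)"
proof -
  have "mdeg (m + Poly_Mapping.single v 1) = 2 \<longleftrightarrow> mdeg m = 1"
    by (simp add: mdeg_add)
  then show ?thesis
    using deg2_eval_single[of "m + Poly_Mapping.single v 1" r]
    by (simp only: Xvar_def mult_single mono_val_add mono_val_single_1 mult.assoc mult_1_right)
qed

lemma deg2_eval_Xvar_Xvar: "cg (deg2_eval c \<theta> (Xvar u * Xvar v)) (\<theta> u * \<theta> v)"
proof -
  have "cg (deg2_eval c \<theta> (Xvar u * Xvar v)) (c 1 * \<theta> u * \<theta> v)"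
    using deg2_eval_single_Xvar[of "Poly_Mapping.single u 1" 1 v]
    by (simp add: Xvar_def[of u] del: One_nat_def)
  also have "cg \<dots> (1 * \<theta> u * \<theta> v)"
    by (intro cg_mult c_1 cg_refl)
  finally show ?thesis by simp
qed

text \<open>The ideal is spanned additively by single terms times relations. Every relation is
  homogeneous of degree one, so only terms of degree one contribute to the quadratic part; hence
  each assumption carries one extra factor \<open>\<theta> w\<close>.\<close>

lemma deg2_eval_sym_ideal:
  assumes f: "f \<in> sym_ideal M N act"
    and add: "\<And>w x y. x \<in> M \<Longrightarrow> y \<in> M \<Longrightarrow> \<theta> w * (\<theta> (x + y) - \<theta> x - \<theta> y) \<in> Z"
    and act: "\<And>w r x. x \<in> M \<Longrightarrow> \<theta> w * (\<theta> (act r x) - c r * \<theta> x) \<in> Z"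
    and zero: "\<And>w x. x \<in> N \<Longrightarrow> \<theta> w * \<theta> x \<in> Z"
    and out: "\<And>w x. x \<notin> M \<Longrightarrow> \<theta> w * \<theta> x \<in> Z"
  shows "deg2_eval c \<theta> f \<in> Z"
proof -
  let ?L = "deg2_eval c \<theta>"
  have *: "?L (Poly_Mapping.single m r * g) \<in> Z" if g: "g \<in> sym_relations M N act" for m r g
  proof -
    let ?s = "Poly_Mapping.single m r"
    \<comment> \<open>The factor by which a multiplying term acts on a linear relation; the value 0
      discards all terms that do not lead to degree two.\<close>
    define k where "k = (if mdeg m = 1 then c r * mono_val \<theta> m else 0)"
    have kX: "cg (?L (?s * Xvar v)) (k * \<theta> v)" for v
      using deg2_eval_single_Xvar[of m r v] by (cases "mdeg m = 1") (simp_all add: k_def)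
    have kZ: "k * x \<in> Z" if "\<And>w. \<theta> w * x \<in> Z" for x
    proof (cases "mdeg m = 1")
      case True
      then obtain w where "m = Poly_Mapping.single w 1" by (rule mdeg_1E)
      then show ?thesis using mult_mem[OF that[of w], of "c r"]
        by (simp add: k_def mult.assoc del: One_nat_def)
    qed (simp add: k_def zero_mem)
    from g consider
      (a) x y where "g = Xvar (x + y) - Xvar x - Xvar y" "x \<in> M" "y \<in> M"
      | (b) r' x where "g = Xvar (act r' x) - Pconst r' * Xvar x" "x \<in> M"
      | (c) x where "g = Xvar x" "x \<in> N" | (d) x where "g = Xvar x" "x \<notin> M"
      unfolding sym_relations_def by blast
    then show ?thesis
    proof cases
      case a
      have "cg (?L (?s * g)) (?L (?s * Xvar (x + y)) - ?L (?s * Xvar x) - ?L (?s * Xvar y))"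
        unfolding a right_diff_distrib by (rule cg_trans[OF deg2_eval_diff cg_diff[OF deg2_eval_diff cg_refl]])
      also have "cg \<dots> (k * \<theta> (x + y) - k * \<theta> x - k * \<theta> y)"
        by (intro cg_diff kX)
      finally show ?thesis
        using kZ[OF add[OF a(2,3)]] by (simp add: cg_mem right_diff_distrib)
    next
      case b
      have "cg (?L (?s * g)) (?L (?s * Xvar (act r' x)) - ?L (Pconst r' * (?s * Xvar x)))"
        using deg2_eval_diff by (simp add: b right_diff_distrib mult_ac)
      also have "cg \<dots> (k * \<theta> (act r' x) - c r' * (k * \<theta> x))"
        by (intro cg_diff kX cg_trans[OF deg2_eval_Pconst cg_mult_left[OF kX]])
      finally show ?thesis
        using kZ[OF act[OF b(2)]] by (simp add: cg_mem right_diff_distrib mult_ac)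
    qed (use kX kZ zero out cg_mem in blast)+
  qed
  have **: "?L (a * g) \<in> Z" if g: "g \<in> sym_relations M N act" for a g
  proof (induction a rule: poly_mapping_additive_induct)
    case zero show ?case by (simp add: deg2_eval_def zero_mem)
  next
    case (single k a) show ?case by (rule *[OF g])
  next
    case (add f h)
    then show ?case using cg_mem[OF deg2_eval_add[of "f * g" "h * g"]] add_mem by (simp add: distrib_right)
  qed
  from f[unfolded sym_ideal_def] show ?thesis
  proof induction
    case zero show ?case by (simp add: deg2_eval_def zero_mem)
  next
    case (step g x a)
    then show ?case using cg_mem[OF deg2_eval_add] ** add_mem by blast
  qed
qed

end

lemma ring_ideal_ideal_gen: "ring_ideal (ideal_gen G)"
proof -
  have add: "x + y \<in> ideal_gen G" if "x \<in> ideal_gen G" "y \<in> ideal_gen G" for x y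
    using that by induction (auto simp: add.assoc intro: ideal_gen.intros)
  have mult: "a * x \<in> ideal_gen G" if "x \<in> ideal_gen G" for a x
    using that by induction (auto simp: distrib_left mult.assoc[symmetric] intro: ideal_gen.intros)
  show ?thesis
  proof
    fix x y assume "x \<in> ideal_gen G" "y \<in> ideal_gen G"
    then show "x - y \<in> ideal_gen G" using add[of x "(-1) * y"] mult[of y "-1"] by simp
  qed (auto intro: mult ideal_gen.zero)
qed

lemma ideal_gen_base: "g \<in> G \<Longrightarrow> g \<in> ideal_gen G"
  using ideal_gen.step[OF _ ideal_gen.zero, of g G 1] by simp

section \<open>The second order Taylor expansion of a symmetric derivation\<close>

locale symder = kalg alg for alg :: "'k::field \<Rightarrow> 'r::comm_ring_1" +
  fixes D :: "('k, 'r) sym_omega1 \<Rightarrow> ('k, 'r) sym_omega1" and half :: 'k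
  assumes D: "symmetric_derivation alg D" and half: "half + half = 1"
begin

definition L :: "('k, 'r) sym_omega1 set" where
  "L = sym_ideal (IR_pre alg) (IR_pow_pre alg 2) tact"

sublocale L: ring_ideal L
  unfolding L_def sym_ideal_def by (rule ring_ideal_ideal_gen)

definition X :: "('r, 'k) tens \<Rightarrow> ('k, 'r) sym_omega1" where "X x = Xvar (rep_tens x)"

lemma X_add: "x \<in> J \<Longrightarrow> y \<in> J \<Longrightarrow> L.cg (X (x + y)) (X x + X y)"
  unfolding L.cg_def unfolding L_def sym_ideal_def X_def J_def rep_simps mem_Collect_eq diff_diff_eq[symmetric]
  by (rule ideal_gen_base, unfold sym_relations_def) blast

lemma X_act: "x \<in> J \<Longrightarrow> L.cg (X (tb r 1 * x)) (Pconst r * X x)"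
  unfolding L.cg_def unfolding L_def sym_ideal_def X_def J_def rep_simps mem_Collect_eq rep_tb tact_def[symmetric]
  by (rule ideal_gen_base, unfold sym_relations_def) blast

lemma X_Q2: "x \<in> Q 2 \<Longrightarrow> X x \<in> L"
  unfolding L_def sym_ideal_def X_def Q_def mem_Collect_eq
  by (rule ideal_gen_base, unfold sym_relations_def) blast

lemma X_cong:
  assumes "x \<in> J" "y \<in> J" "Q2.cg x y" shows "L.cg (X x) (X y)"
proof -
  have "L.cg (X ((x - y) + y)) (X (x - y) + X y)"
    by (rule X_add) (use assms J.diff_mem in auto)
  also have "L.cg \<dots> (0 + X y)"
    by (intro L.cg_add L.cg_refl) (use assms X_Q2 in \<open>auto simp: Q2.cg_def L.cg_0_iff\<close>)
  finally show ?thesis by simp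
qed

lemma D_cong: "L.cg f g \<Longrightarrow> L.cg (D f) (D g)"
  and D_lin: "L.cg (D (Pconst (alg c) * f + g)) (Pconst (alg c) * D f + D g)"
  and D_mult: "L.cg (D (f * g)) (f * D g + g * D f)"
  and D_const: "L.cg (D (Pconst r)) (X (tb 1 r - tb r 1))"
  using D unfolding L.cg_def by (simp_all add: symmetric_derivation_def Let_def L_def X_def delta_rep_def)

lemma D_add: "L.cg (D (f + g)) (D f + D g)"
  using D_lin[of 1] by simp

lemma D_scal: "L.cg (D (Pconst (alg c) * f)) (Pconst (alg c) * D f)"
proof -
  have "L.cg (D 0) 0" by (rule L.cg_additive_0[OF D_add])
  from L.cg_trans[OF D_lin[of c f 0] L.cg_add[OF L.cg_refl this]] show ?thesis by simp
qed

text \<open>\<open>d1\<close> and \<open>d2\<close> are the first two Taylor coefficients \<open>D\<close> and \<open>D\<^sup>2/2\<close> of the formal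
  exponential of \<open>D\<close>; this is what makes \<open>d2_mult\<close> come out without binomial factors.\<close>

definition d1 :: "'r \<Rightarrow> ('k, 'r) sym_omega1" where "d1 b = D (Pconst b)"
definition d2 :: "'r \<Rightarrow> ('k, 'r) sym_omega1" where "d2 b = Pconst (alg half) * D (d1 b)"

lemma d1_add: "L.cg (d1 (a + b)) (d1 a + d1 b)"
  using D_add by (simp add: d1_def Pconst_add)

lemma d1_scal: "L.cg (d1 (alg c * b)) (Pconst (alg c) * d1 b)"
  using D_scal by (simp add: d1_def Pconst_mult)

lemma d1_mult: "L.cg (d1 (a * b)) (Pconst a * d1 b + Pconst b * d1 a)"
  using D_mult by (simp add: d1_def Pconst_mult)

lemma d2_add: "L.cg (d2 (a + b)) (d2 a + d2 b)"
  using L.cg_mult_left[OF L.cg_trans[OF D_cong[OF d1_add[of a b]] D_add], of "Pconst (alg half)"]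
  by (simp add: d2_def distrib_left)

lemma d2_scal: "L.cg (d2 (alg c * b)) (Pconst (alg c) * d2 b)"
  using L.cg_mult_left[OF L.cg_trans[OF D_cong[OF d1_scal[of c b]] D_scal], of "Pconst (alg half)"]
  by (simp add: d2_def mult_ac)

lemma d2_mult: "L.cg (d2 (a * b)) (Pconst a * d2 b + Pconst b * d2 a + d1 a * d1 b)"
proof -
  have "L.cg (D (d1 (a * b))) (D (Pconst a * d1 b) + D (Pconst b * d1 a))"
    by (rule L.cg_trans[OF D_cong[OF d1_mult] D_add])
  also have "L.cg \<dots> (Pconst a * D (d1 b) + d1 b * d1 a + (Pconst b * D (d1 a) + d1 a * d1 b))"
    unfolding d1_def by (intro L.cg_add D_mult)
  finally have "L.cg (d2 (a * b)) (Pconst (alg half) * \<dots>)"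
    unfolding d2_def by (rule L.cg_mult_left)
  \<comment> \<open>The two Leibniz cross terms coincide in the commutative ring, so their
    coefficients 1/2 add up to 1.\<close>
  also have "Pconst (alg half) * (Pconst a * D (d1 b) + d1 b * d1 a + (Pconst b * D (d1 a) + d1 a * d1 b))
    = Pconst a * d2 b + Pconst b * d2 a + (Pconst (alg half) + Pconst (alg half)) * (d1 a * d1 b)"
    by (simp add: d2_def algebra_simps)
  also have "Pconst (alg half) + Pconst (alg half) = (1 :: ('k, 'r) sym_omega1)"
    by (simp flip: Pconst_add alg_add add: half)
  finally show ?thesis by simp
qed

section \<open>Left linear extension of Taylor coefficients to the tensor square\<close>

text \<open>The map \<open>a \<otimes> b \<mapsto> a * d b\<close>. On \<open>tens\<close> it makes
  sense for any \<open>d\<close>; it descends to the tensor square when \<open>d\<close> is linear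
  modulo \<open>L\<close>, see \<open>lext_K\<close>.\<close>

definition lext :: "('r \<Rightarrow> ('k, 'r) sym_omega1) \<Rightarrow> ('r, 'k) tens \<Rightarrow> ('k, 'r) sym_omega1" where
  "lext d x = psum (\<lambda>p k. Pconst (alg k * fst p) * d (snd p)) (rep_tens x)"

lemma lext_add: "lext d (x + y) = lext d x + lext d y"
  unfolding lext_def rep_simps by (rule psum_add) (auto simp: alg_add Pconst_add distrib_right)

lemma lext_single: "lext d (sc k * tb a b) = Pconst (alg k * a) * d b"
  unfolding abs_single[symmetric] lext_def by (simp add: psum_single)

lemma lext_tb: "lext d (tb a b) = Pconst a * d b"
  using lext_single[of d 1] by simp

lemma lext_0: "lext d 0 = 0" using lext_add[of d 0 0] by simp

lemma lext_diff: "lext d (x - y) = lext d x - lext d y"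
  using lext_add[of d "x - y" y] by (simp add: algebra_simps)

lemma lext_act: "lext d (tb r 1 * x) = Pconst r * lext d x"
proof (rule tens_eqI[of "\<lambda>x. lext d (tb r 1 * x)"])
  fix k a b
  have "tb r 1 * (sc k * tb a b) = sc k * (tb (r * a) b :: ('r, 'k) tens)"
    by (simp add: tb_mult mult.left_commute[of "tb r 1"])
  then show "lext d (tb r 1 * (sc k * tb a b)) = Pconst r * lext d (sc k * tb a b)"
    by (simp add: lext_single Pconst_mult mult_ac)
qed (simp_all add: lext_add distrib_left)

lemma lext_sc: "lext d (sc c * x) = Pconst (alg c) * lext d x"
proof (rule tens_eqI[of "\<lambda>x. lext d (sc c * x)"])
  fix k a b
  have *: "sc c * (sc k * tb a b) = sc (c * k) * (tb a b :: ('r, 'k) tens)"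
    by (simp add: sc_mult mult_ac)
  show "lext d (sc c * (sc k * tb a b)) = Pconst (alg c) * lext d (sc k * tb a b)"
    unfolding * lext_single alg_mult Pconst_mult by (simp only: mult_ac)
qed (simp_all add: lext_add distrib_left)

text \<open>The relations in the left factor go to exactly 0. Those in the right factor go to
  multiples of the failure of \<open>d\<close> to be additive or homogeneous, which lies in
  \<open>L\<close>.\<close>

lemma lext_K:
  assumes add: "\<And>a b. L.cg (d (a + b)) (d a + d b)"
    and scal: "\<And>c b. L.cg (d (alg c * b)) (Pconst (alg c) * d b)" and x: "x \<in> K"
  shows "lext d x \<in> L"
proof -
  have "rep_tens x \<in> kspan (tensor_relations alg)" using x by (simp add: K_def tensor_kernel_def)
  then have "lext d (abs_tens (rep_tens x)) \<in> L"
  proof induction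
    case zero then show ?case by (simp add: abs_simps lext_0 L.zero_mem)
  next
    case (step s x c)
    from step(1) consider
      (a) a a' b where "s = tbasis (a + a') b - tbasis a b - tbasis a' b"
      | (b) a b b' where "s = tbasis a (b + b') - tbasis a b - tbasis a b'"
      | (c) c a b where "s = tbasis (alg c * a) b - ksmul c (tbasis a b)"
      | (d) c a b where "s = tbasis a (alg c * b) - ksmul c (tbasis a b)"
      unfolding tensor_relations_def by blast
    then have "lext d (abs_tens s) \<in> L"
    proof cases
      case a
      then have "lext d (abs_tens s) = 0"
        by (simp add: abs_simps lext_diff lext_tb Pconst_add distrib_right flip: tb_def)
      then show ?thesis by (simp add: L.zero_mem)
    next
      case b
      then have "lext d (abs_tens s) = Pconst a * d (b + b') - Pconst a * d b - Pconst a * d b'"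
        by (simp only: abs_simps lext_diff lext_tb flip: tb_def)
      then have "lext d (abs_tens s) = Pconst a * (d (b + b') - (d b + d b'))"
        by (simp add: algebra_simps)
      then show ?thesis
        using L.mult_mem[OF add[unfolded L.cg_def, of b b'], of "Pconst a"] by simp
    next
      case c
      then have "lext d (abs_tens s) = 0"
        by (simp add: abs_simps abs_ksmul lext_diff lext_tb lext_single flip: tb_def)
      then show ?thesis by (simp add: L.zero_mem)
    next
      case d
      then show ?thesis
        using L.mult_mem[OF scal[unfolded L.cg_def], of "Pconst a"]
        by (simp add: abs_simps abs_ksmul lext_diff lext_tb lext_single right_diff_distrib Pconst_mult mult_ac
            flip: tb_def)
    qed
    then show ?case
      using step by (simp add: abs_simps abs_ksmul lext_add lext_sc L.mult_mem L.add_mem)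
  qed
  then show ?thesis by simp
qed

text \<open>The product rule for the coefficient of t^2 in a power series with coefficients
  \<open>mm\<close>, \<open>lext d'\<close>, \<open>lext d\<close>. Both sides are additive in each
  argument, so it is enough to compare scaled pure tensors, where it is the assumption multiplied by
  the left factors.\<close>

lemma lext_mult:
  assumes d: "\<And>a b. L.cg (d (a * b)) (Pconst a * d b + Pconst b * d a + d' a * d' b)"
  shows "L.cg (lext d (x * y)) (Pconst (mm x) * lext d y + Pconst (mm y) * lext d x + lext d' x * lext d' y)"
proof (rule L.tens_ext[of "\<lambda>x. lext d (x * y)"])
  fix k :: 'k and a b :: 'r
  let ?s = "sc k * tb a b"
  show "L.cg (lext d (?s * y)) (Pconst (mm ?s) * lext d y + Pconst (mm y) * lext d ?s + lext d' ?s * lext d' y)"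
  proof (rule L.tens_ext[of "\<lambda>y. lext d (?s * y)"])
    fix k' :: 'k and a' b' :: 'r
    have "?s * (sc k' * tb a' b') = sc (k * k') * (tb (a * a') (b * b') :: ('r, 'k) tens)"
      by (simp add: sc_mult tb_mult[symmetric] mult_ac)
    then have "lext d (?s * (sc k' * tb a' b')) = Pconst (alg (k * k') * (a * a')) * d (b * b')"
      by (simp only: lext_single)
    also have "L.cg \<dots> (Pconst (alg (k * k') * (a * a')) * (Pconst b * d b' + Pconst b' * d b + d' b * d' b'))"
      by (rule L.cg_mult_left[OF d])
    also have "\<dots> = Pconst (mm ?s) * lext d (sc k' * tb a' b') + Pconst (mm (sc k' * tb a' b')) * lext d ?s
        + lext d' ?s * lext d' (sc k' * tb a' b')"
      by (simp add: lext_single mm_single alg_mult Pconst_mult algebra_simps)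
    finally show "L.cg (lext d (?s * (sc k' * tb a' b'))) \<dots>" .
  qed (simp_all add: lext_add mm_add Pconst_add algebra_simps)
qed (simp_all add: lext_add mm_add Pconst_add algebra_simps)

lemma lext_d2_mult: "L.cg (lext d2 (x * y)) (Pconst (mm x) * lext d2 y + Pconst (mm y) * lext d2 x + lext d1 x * lext d1 y)"
  by (rule lext_mult[OF d2_mult])

text \<open>The reason is the identity \<open>a \<otimes> b - ab \<otimes> 1 = a (1 \<otimes> b - b
  \<otimes> 1)\<close>, whose right side has class \<open>a * d1 b\<close> in Omega^(1).\<close>

lemma lext_d1_X: assumes "x \<in> J" shows "L.cg (lext d1 x) (X x)"
proof -
  \<comment> \<open>\<open>X\<close> is additive only on \<open>J\<close>, while extensionality
    compares maps on all of \<open>tens\<close>. So \<open>X\<close> is precomposed with this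
    projection onto \<open>J\<close>, which is the identity on \<open>J\<close> modulo
    \<open>K\<close>.\<close>
  define g where "g x = x - tb (mm x) 1" for x :: "('r, 'k) tens"
  have gJ: "g x \<in> J" for x by (simp add: g_def J_iff mm_diff mm_tb)
  have "L.cg (lext d1 x) (X (g x))"
  proof (rule L.tens_ext[of "lext d1" "\<lambda>x. X (g x)"])
    fix x y :: "('r, 'k) tens"
    have "K.cg (x + y - tb (mm (x + y)) 1) (x + y - (tb (mm x) 1 + tb (mm y) 1))"
      unfolding mm_add by (intro K.cg_diff K.cg_refl tb_add_left)
    then have "K.cg (g (x + y)) (g x + g y)"
      unfolding g_def by (simp add: algebra_simps)
    then have "L.cg (X (g (x + y))) (X (g x + g y))"
      by (intro X_cong K_cg_Q2 gJ J.add_mem)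
    also have "L.cg \<dots> (X (g x) + X (g y))" by (intro X_add gJ)
    finally show "L.cg (X (g (x + y))) (X (g x) + X (g y))" .
  next
    fix k :: 'k and a b :: 'r
    have J: "tb 1 b - tb b 1 \<in> J" by (simp add: J_iff mm_diff mm_tb)
    have "lext d1 (sc k * tb a b) = Pconst (alg k * a) * d1 b" by (rule lext_single)
    also have "L.cg \<dots> (Pconst (alg k * a) * X (tb 1 b - tb b 1))"
      unfolding d1_def by (rule L.cg_mult_left[OF D_const])
    also have "L.cg \<dots> (X (tb (alg k * a) 1 * (tb 1 b - tb b 1)))"
      by (rule L.cg_sym[OF X_act[OF J]])
    also have "tb (alg k * a) 1 * (tb 1 b - tb b 1) = (tb (alg k * a) b - tb (alg k * a * b) 1 :: ('r, 'k) tens)"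
      by (simp add: right_diff_distrib tb_mult)
    also have "L.cg (X \<dots>) (X (g (sc k * tb a b)))"
      by (intro X_cong K_cg_Q2 gJ, simp add: J_iff mm_diff mm_tb)
         (simp only: g_def mm_single, intro K.cg_diff K.cg_refl tb_alg)
    finally show "L.cg (lext d1 (sc k * tb a b)) (X (g (sc k * tb a b)))" .
  qed (simp add: lext_add)
  also have "L.cg (X (g x)) (X x)"
  proof (intro X_cong K_cg_Q2 gJ assms)
    have "K.cg (tb 0 1 :: ('r, 'k) tens) 0"
      by (rule K.cg_additive_0[OF tb_add_left])
    from K.cg_diff[OF K.cg_refl this, of x] show "K.cg (g x) x"
      using assms by (simp add: g_def J_iff)
  qed
  finally show ?thesis .
qed

definition taylor2 :: "('r, 'k) tens \<Rightarrow> ('k, 'r) sym_omega1" where "taylor2 = lext d2"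

lemma taylor2_add: "taylor2 (x + y) = taylor2 x + taylor2 y"
  and taylor2_act: "taylor2 (tb r 1 * x) = Pconst r * taylor2 x"
  and taylor2_sc: "taylor2 (sc c * x) = Pconst (alg c) * taylor2 x"
  and taylor2_0: "taylor2 0 = 0" and taylor2_diff: "taylor2 (x - y) = taylor2 x - taylor2 y"
  by (simp_all add: taylor2_def lext_add lext_act lext_sc lext_0 lext_diff)

lemma taylor2_prod: "u \<in> J \<Longrightarrow> v \<in> J \<Longrightarrow> L.cg (taylor2 (u * v)) (X u * X v)"
  using L.cg_trans[OF lext_d2_mult[of u v] L.cg_add[OF L.cg_refl L.cg_mult[OF lext_d1_X lext_d1_X]]]
  by (simp add: taylor2_def J_iff)

lemma taylor2_Q3: "x \<in> Q 3 \<Longrightarrow> taylor2 x \<in> L"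
proof -
  assume x: "x \<in> Q 3"
  have "x \<in> {x. taylor2 x \<in> L}"
  proof (rule Q3_least[OF x])
    show "add_subgroup {x. taylor2 x \<in> L}"
      by unfold_locales (simp_all add: taylor2_0 taylor2_diff L.zero_mem L.diff_mem)
    show "K \<subseteq> {x. taylor2 x \<in> L}" unfolding taylor2_def using lext_K[OF d2_add d2_scal] by blast
  next
    fix c y assume "y \<in> {x. taylor2 x \<in> L}"
    then show "sc c * y \<in> {x. taylor2 x \<in> L}" by (simp add: taylor2_sc L.mult_mem)
  next
    fix u v w assume J: "u \<in> J" "v \<in> J" "w \<in> J"
    have "L.cg (taylor2 (u * (v * w))) (X u * X (v * w))"
      using J J.mult_mem by (intro taylor2_prod) auto
    \<comment> \<open>The product \<open>v * w\<close> lies in I^2, so its class in Omega^(1) is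
      zero.\<close>
    moreover have "X u * X (v * w) \<in> L"
      using J by (intro L.mult_mem X_Q2 Q2_prod)
    ultimately show "u * (v * w) \<in> {x. taylor2 x \<in> L}" using L.cg_mem by blast
  qed
  then show ?thesis by simp
qed

end

section \<open>Dual bases\<close>

lemma keys_psum:
  assumes "\<And>k a. Poly_Mapping.keys (T k a) \<subseteq> A"
  shows "Poly_Mapping.keys (psum T f) \<subseteq> A"
proof -
  have "Poly_Mapping.keys (\<Sum>k\<in>S. T k (Poly_Mapping.lookup f k)) \<subseteq> A" if "finite S" for S
    using that
  proof induction
    case (insert x S)
    then show ?case using assms keys_add by (fastforce simp: subset_iff)
  qed simp
  then show ?thesis by (simp add: psum_def)
qed

text \<open>The linear map of free modules induced by a map of index sets. \<open>g\<close> need not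
  be injective: coefficients whose indices collide are added.\<close>

definition rekey :: "('i \<Rightarrow> 'j) \<Rightarrow> ('i \<Rightarrow>\<^sub>0 'r::comm_ring_1) \<Rightarrow> ('j \<Rightarrow>\<^sub>0 'r)" where
  "rekey g = psum (\<lambda>i. Poly_Mapping.single (g i))"

lemma rekey_add: "rekey g (f + f') = rekey g f + rekey g f'"
  unfolding rekey_def by (rule psum_add) (simp_all add: single_add)

lemma rekey_single [simp]: "rekey g (Poly_Mapping.single i r) = Poly_Mapping.single (g i) r"
  unfolding rekey_def by (rule psum_single) simp

lemma rekey_0 [simp]: "rekey g 0 = 0"
  by (simp add: rekey_def)

lemma rekey_free_rmul: "rekey g (free_rmul r f) = free_rmul r (rekey g f)"
  by (rule psum_ext[of "\<lambda>f. rekey g (free_rmul r f)"]) (simp_all add: rekey_add free_rmul_add)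

lemma rekey_rekey: "rekey g (rekey h f) = rekey (\<lambda>i. g (h i)) f"
  by (rule psum_ext[of "\<lambda>f. rekey g (rekey h f)"]) (simp_all add: rekey_add)

lemma rekey_id: "rekey (\<lambda>i. i) f = f"
  by (rule psum_ext[of "rekey (\<lambda>i. i)"]) (simp_all add: rekey_add)

lemma keys_rekey: "Poly_Mapping.keys (rekey g f) \<subseteq> g ` Poly_Mapping.keys f"
proof -
  have "Poly_Mapping.keys (\<Sum>k\<in>S. Poly_Mapping.single (g k) (Poly_Mapping.lookup f k)) \<subseteq> g ` S"
    if "finite S" for S
    using that
  proof induction
    case (insert x S)
    have "Poly_Mapping.keys (Poly_Mapping.single (g x) (Poly_Mapping.lookup f x)) \<subseteq> {g x}" by simp
    then show ?case using insert keys_add by (fastforce simp: subset_iff)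
  qed simp
  then show ?thesis by (simp add: rekey_def psum_def)
qed

context kalg
begin

text \<open>Every basis vector is indexed by the element that it stands for. So one fixed map to
  \<open>tens\<close> serves all families of generators.\<close>

definition lin :: "(('r, 'k) tens \<Rightarrow>\<^sub>0 'r) \<Rightarrow> ('r, 'k) tens" where
  "lin = psum (\<lambda>i r. tb r 1 * i)"

lemma K_cg_tb_0: "K.cg (tb 0 1) 0"
  by (rule K.cg_additive_0[OF tb_add_left])

lemma deg2_tb: "ring_ideal Z \<Longrightarrow> K \<subseteq> Z \<Longrightarrow> deg2 Z (\<lambda>r. tb r 1)"
proof -
  assume Z: "ring_ideal Z" "K \<subseteq> Z"
  interpret Z: ring_ideal Z by fact
  show ?thesis
    by unfold_locales (use tb_add_left Z in \<open>auto simp: K.cg_def Z.cg_def tb_mult tb_1 Z.zero_mem\<close>)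
qed

lemma lin_add: "K.cg (lin (f + g)) (lin f + lin g)"
  unfolding lin_def
proof (rule K.cg_psum_add)
  fix k :: "('r, 'k) tens" and a b
  show "K.cg (tb 0 1 * k) 0"
    using K.cg_mult[OF K_cg_tb_0 K.cg_refl] by simp
  show "K.cg (tb (a + b) 1 * k) (tb a 1 * k + tb b 1 * k)"
    using K.cg_mult[OF tb_add_left K.cg_refl] by (simp add: distrib_right)
qed

lemma lin_single: "K.cg (lin (Poly_Mapping.single i r)) (tb r 1 * i)"
  unfolding lin_def by (rule K.cg_psum_single) (use K.cg_mult[OF K_cg_tb_0 K.cg_refl] in simp)

lemma lin_free_rmul: "K.cg (lin (free_rmul r f)) (tb r 1 * lin f)"
proof (rule K.additive_ext[of "\<lambda>f. lin (free_rmul r f)"])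
  fix k :: "('r, 'k) tens" and a
  have "K.cg (lin (free_rmul r (Poly_Mapping.single k a))) (tb (r * a) 1 * k)"
    by (simp add: lin_single)
  also have "tb (r * a) 1 * k = tb r 1 * (tb a 1 * k)"
    by (simp add: tb_mult flip: mult.assoc)
  also have "K.cg \<dots> (tb r 1 * lin (Poly_Mapping.single k a))"
    by (intro K.cg_mult_left K.cg_sym[OF lin_single])
  finally show "K.cg (lin (free_rmul r (Poly_Mapping.single k a))) (tb r 1 * lin (Poly_Mapping.single k a))" .
next
  fix f g :: "('r, 'k) tens \<Rightarrow>\<^sub>0 'r"
  show "K.cg (tb r 1 * lin (f + g)) (tb r 1 * lin f + tb r 1 * lin g)"
    using K.cg_mult_left[OF lin_add] by (simp add: distrib_left)
qed (simp add: free_rmul_add lin_add)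

lemma lin_mem: "Poly_Mapping.keys f \<subseteq> J \<Longrightarrow> lin f \<in> J"
  unfolding lin_def by (rule J.psum_mem) (auto intro: J.mult_mem)

text \<open>The dual basis criterion for \<open>J\<close> modulo \<open>N\<close>:
  \<open>s y\<close> lists the values of the coordinate functionals on \<open>y\<close>, and the
  indices are the generators. Of the section and retraction in \<open>projective_quot\<close> only
  the section remains as data.\<close>

definition dual_basis :: "('r, 'k) tens set \<Rightarrow> (('r, 'k) tens \<Rightarrow> ('r, 'k) tens \<Rightarrow>\<^sub>0 'r) \<Rightarrow> bool" where
  "dual_basis N s \<longleftrightarrow> (\<forall>y\<in>J. Poly_Mapping.keys (s y) \<subseteq> J)
     \<and> (\<forall>x\<in>J. \<forall>y\<in>J. s (x + y) = s x + s y)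
     \<and> (\<forall>r. \<forall>x\<in>J. s (tb r 1 * x) = free_rmul r (s x))
     \<and> (\<forall>x\<in>N. s x = 0)
     \<and> (\<forall>y\<in>J. lin (s y) - y \<in> N)"

lemma dual_basis_cong:
  assumes s: "dual_basis N s" and "x \<in> J" "y \<in> J" "x - y \<in> N"
  shows "s x = s y"
proof -
  have "s ((x - y) + y) = s (x - y) + s y"
    using s assms J.diff_mem unfolding dual_basis_def by blast
  also have "s (x - y) = 0" using s assms by (auto simp: dual_basis_def)
  finally show ?thesis by simp
qed

text \<open>Modulo \<open>N\<close> a retraction \<open>p\<close> is determined by the images of the
  basis vectors. Reindexing the free module by these images turns \<open>p\<close> into
  \<open>lin\<close>; conversely, \<open>lin\<close> on the free module over all of \<open>J\<close>
  is a retraction.\<close>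

lemma Omega_projective_iff:
  "Omega_projective alg q \<longleftrightarrow> (\<exists>s. dual_basis (Q (Suc q)) s)"
proof
  let ?N = "Q (Suc q)" and ?M = "IR_pre alg" and ?NM = "IR_pow_pre alg (Suc q)"
  interpret N: ring_ideal ?N by (rule ring_ideal_Q)
  have KN: "N.cg x y" if "K.cg x y" for x y
    using that K_subset_Q by (auto simp: N.cg_def K.cg_def)
  have N_abs: "abs_tens x \<in> ?N \<longleftrightarrow> x \<in> ?NM" and M_abs: "abs_tens x \<in> J \<longleftrightarrow> x \<in> ?M" for x
    by (simp_all add: Q_def J_def)
  {
    assume "Omega_projective alg q"
    then obtain I :: "('r \<times> 'r \<Rightarrow>\<^sub>0 'k) set" and s p where
      keys [rule_format]: "\<forall>x\<in>?M. Poly_Mapping.keys (s x) \<subseteq> I" and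
      cong [rule_format]: "\<forall>x\<in>?M. \<forall>y\<in>?M. x - y \<in> ?NM \<longrightarrow> s x = s y" and
      add [rule_format]: "\<forall>x\<in>?M. \<forall>y\<in>?M. s (x + y) = s x + s y" and
      act [rule_format]: "\<forall>r. \<forall>x\<in>?M. s (tact r x) = free_rmul r (s x)" and
      pM [rule_format]: "\<forall>f. Poly_Mapping.keys f \<subseteq> I \<longrightarrow> p f \<in> ?M" and
      p_add [rule_format]: "\<forall>f g. Poly_Mapping.keys f \<subseteq> I \<longrightarrow> Poly_Mapping.keys g \<subseteq> I
        \<longrightarrow> p (f + g) - (p f + p g) \<in> ?NM" and
      p_act [rule_format]: "\<forall>r f. Poly_Mapping.keys f \<subseteq> I \<longrightarrow>
        p (free_rmul r f) - tact r (p f) \<in> ?NM" and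
      ps [rule_format]: "\<forall>x\<in>?M. p (s x) - x \<in> ?NM"
      unfolding Omega_projective_def projective_quot_def by (elim exE conjE) (rule that; assumption)
    define g where "g i = abs_tens (p (Poly_Mapping.single i 1))" for i
    have gJ: "g i \<in> J" if "i \<in> I" for i using that pM by (simp add: g_def M_abs)
    \<comment> \<open>Linearity of \<open>p\<close> is known only for supports inside
      \<open>I\<close>, hence the induction that keeps the support under control.\<close>
    have p_lin: "N.cg (lin (rekey g f)) (abs_tens (p f))" if "Poly_Mapping.keys f \<subseteq> I" for f
      using that
    proof (induction f rule: poly_mapping_additive_induct_keys)
      case zero
      have "N.cg (abs_tens (p 0)) (abs_tens (p 0) + abs_tens (p 0))"
        using p_add[of 0 0] by (simp add: N.cg_def flip: N_abs add: abs_simps)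
      then have "N.cg (abs_tens (p 0)) 0" using N.minus_mem by (fastforce simp: N.cg_def)
      then show ?case by (simp add: lin_def N.cg_sym)
    next
      case (single i r)
      have "N.cg (lin (rekey g (Poly_Mapping.single i r))) (tb r 1 * g i)"
        by (simp add: KN lin_single)
      also have "N.cg \<dots> (abs_tens (p (free_rmul r (Poly_Mapping.single i 1))))"
        using p_act[of "Poly_Mapping.single i 1" r] single
        by - (rule N.cg_sym, simp add: N.cg_def g_def tact_abs tb_def abs_simps flip: N_abs)
      finally show ?case by simp
    next
      case (add f h)
      have "N.cg (lin (rekey g (f + h))) (lin (rekey g f) + lin (rekey g h))"
        by (simp add: rekey_add KN lin_add)
      also have "N.cg \<dots> (abs_tens (p f) + abs_tens (p h))" by (intro N.cg_add add)
      also have "N.cg \<dots> (abs_tens (p (f + h)))"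
        using p_add[OF add(1,2)] by - (rule N.cg_sym, simp add: N.cg_def abs_simps flip: N_abs)
      finally show ?case .
    qed
    have "dual_basis ?N (\<lambda>y. rekey g (s (rep_tens y)))"
      unfolding dual_basis_def
    proof (intro conjI ballI allI)
      fix y assume y: "y \<in> J"
      then have yM: "rep_tens y \<in> ?M" by (simp add: J_def)
      show "Poly_Mapping.keys (rekey g (s (rep_tens y))) \<subseteq> J"
        using keys[OF yM] keys_rekey[of g "s (rep_tens y)"] gJ by blast
      have "N.cg (lin (rekey g (s (rep_tens y)))) (abs_tens (p (s (rep_tens y))))"
        by (rule p_lin[OF keys[OF yM]])
      also have "N.cg \<dots> y"
        using ps[OF yM] by (simp add: N.cg_def abs_simps flip: N_abs)
      finally show "lin (rekey g (s (rep_tens y))) - y \<in> ?N" by (simp add: N.cg_def)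
      fix r
      show "rekey g (s (rep_tens (tb r 1 * y))) = free_rmul r (rekey g (s (rep_tens y)))"
        using act[OF yM, of r] by (simp add: tact_def rekey_free_rmul)
    next
      fix x y assume "x \<in> J" "y \<in> J"
      then show "rekey g (s (rep_tens (x + y))) = rekey g (s (rep_tens x)) + rekey g (s (rep_tens y))"
        by (simp add: J_def add rekey_add)
    next
      fix x assume x: "x \<in> ?N"
      then have "rep_tens x \<in> ?M" "0 \<in> ?M" "rep_tens x - 0 \<in> ?NM"
        using Q_subset_J J.zero_mem by (auto simp: J_def Q_def)
      then have "s (rep_tens x) = s 0" using cong by blast
      also have "s 0 = 0" using add[of 0 0] \<open>0 \<in> ?M\<close> by simp
      finally show "rekey g (s (rep_tens x)) = 0" by simp
    qed
    then show "\<exists>s. dual_basis ?N s" by blast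
  next
    assume "\<exists>s. dual_basis ?N s"
    then obtain s where s: "dual_basis ?N s" by blast
    have kJ: "Poly_Mapping.keys (rekey abs_tens f) \<subseteq> J" if "Poly_Mapping.keys f \<subseteq> ?M" for f
      using that keys_rekey[of abs_tens f] M_abs by blast
    have sJ: "Poly_Mapping.keys (s y) \<subseteq> J" "lin (s y) - y \<in> ?N" if "y \<in> J" for y
      using that s by (auto simp: dual_basis_def)
    show "Omega_projective alg q"
      unfolding Omega_projective_def projective_quot_def
    proof (rule exI[of _ ?M], rule exI[of _ "\<lambda>x. rekey rep_tens (s (abs_tens x))"],
        rule exI[of _ "\<lambda>f. rep_tens (lin (rekey abs_tens f))"], intro conjI ballI allI impI)
      fix x assume x: "x \<in> ?M"
      then have xJ: "abs_tens x \<in> J" by (simp add: M_abs)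
      show "Poly_Mapping.keys (rekey rep_tens (s (abs_tens x))) \<subseteq> ?M"
        using keys_rekey[of rep_tens "s (abs_tens x)"] sJ[OF xJ] by (auto simp: J_def)
      show "rep_tens (lin (rekey abs_tens (rekey rep_tens (s (abs_tens x))))) - x \<in> ?NM"
        using sJ(2)[OF xJ] by (simp add: rekey_rekey rekey_id Q_def)
      show "rekey rep_tens (s (abs_tens (tact r x))) = free_rmul r (rekey rep_tens (s (abs_tens x)))" for r
        using s xJ by (simp add: dual_basis_def tact_def abs_simps rekey_free_rmul flip: tb_def)
      fix y assume "y \<in> ?M"
      then have yJ: "abs_tens y \<in> J" by (simp add: M_abs)
      show "rekey rep_tens (s (abs_tens (x + y))) = rekey rep_tens (s (abs_tens x)) + rekey rep_tens (s (abs_tens y))"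
        using s xJ yJ by (simp add: dual_basis_def abs_simps rekey_add)
      show "rekey rep_tens (s (abs_tens x)) = rekey rep_tens (s (abs_tens y))" if "x - y \<in> ?NM"
        using dual_basis_cong[OF s xJ yJ] that by (simp flip: N_abs add: abs_simps)
    next
      fix f :: "('r \<times> 'r \<Rightarrow>\<^sub>0 'k) \<Rightarrow>\<^sub>0 'r" assume f: "Poly_Mapping.keys f \<subseteq> ?M"
      show "rep_tens (lin (rekey abs_tens f)) \<in> ?M" using lin_mem[OF kJ[OF f]] by (simp add: J_def)
      show "rep_tens (lin (rekey abs_tens (free_rmul r f))) - tact r (rep_tens (lin (rekey abs_tens f))) \<in> ?NM" for r
        using KN[OF lin_free_rmul[of r "rekey abs_tens f"]] unfolding N.cg_def
        by (simp add: Q_def rekey_free_rmul tact_abs)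
      show "rep_tens (lin (rekey abs_tens (f + g))) - (rep_tens (lin (rekey abs_tens f)) + rep_tens (lin (rekey abs_tens g))) \<in> ?NM" for g
        using KN[OF lin_add[of "rekey abs_tens f" "rekey abs_tens g"]] unfolding N.cg_def
        by (simp add: Q_def rekey_add)
    qed
  }
qed

end

section \<open>The splitting\<close>

text \<open>Modulo \<open>Q 3\<close>, the map \<open>e\<close> extends the identity of \<open>I\<^sup>2/I\<^sup>3\<close> to \<open>\<Omega>\<^sup>(\<^sup>2\<^sup>)\<close>.\<close>

locale splitting = kalg alg for alg :: "'k::field \<Rightarrow> 'r::comm_ring_1" +
  fixes e :: "('r, 'k) tens \<Rightarrow> ('r, 'k) tens"
  assumes e_add: "Q3.cg (e (x + y)) (e x + e y)"
    and e_tb: "Q3.cg (e (tb r 1 * x)) (tb r 1 * e x)"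
    and e_Q3: "x \<in> Q 3 \<Longrightarrow> e x \<in> Q 3"
    and e_prod: "u \<in> J \<Longrightarrow> v \<in> J \<Longrightarrow> Q3.cg (e (u * v)) (u * v)"
begin

lemma e_diff: "Q3.cg (e (x - y)) (e x - e y)"
  using Q3.cg_diff[OF Q3.cg_sym[OF e_add[of "x - y" y]] Q3.cg_refl[of "e y"]] Q3.cg_sym by simp

lemma e_cong: "Q3.cg x y \<Longrightarrow> Q3.cg (e x) (e y)"
  using e_Q3[of "x - y"] Q3.cg_mem[OF e_diff[of x y]] by (simp add: Q3.cg_def)

text \<open>The products in \<open>e_prod\<close> span I^2 modulo \<open>K\<close>, and
  \<open>e\<close> respects congruence modulo \<open>Q 3\<close>.\<close>

lemma e_Q2:
  assumes "x \<in> Q 2" shows "Q3.cg (e x) x"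
proof -
  have "x \<in> {x. Q3.cg (e x) x}"
  proof (rule Q2_least[OF assms])
    show "add_subgroup {x. Q3.cg (e x) x}"
    proof
      show "0 \<in> {x. Q3.cg (e x) x}"
        using e_Q3[OF Q3.zero_mem] by (simp add: Q3.cg_0_iff)
    qed (use Q3.cg_trans[OF e_diff Q3.cg_diff] in blast)
    show "K \<subseteq> {x. Q3.cg (e x) x}"
      using K_subset_Q[of 3] e_Q3 Q3.diff_mem unfolding Q3.cg_def by blast
  next
    fix c y assume y: "y \<in> {x. Q3.cg (e x) x}"
    \<comment> \<open>\<open>e\<close> is assumed linear for the left action of \<open>R\<close>
      only, so the scalar is first carried into \<open>R\<close>.\<close>
    have *: "Q3.cg (tb (alg c) 1 * y) (sc c * y)"
      using K_cg_Q3[OF K.cg_mult[OF tb_alg[of c 1 1] K.cg_refl[of y]]] by (simp add: tb_1)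
    have "Q3.cg (e (sc c * y)) (e (tb (alg c) 1 * y))" by (rule e_cong[OF Q3.cg_sym[OF *]])
    also have "Q3.cg \<dots> (tb (alg c) 1 * e y)" by (rule e_tb)
    also have "Q3.cg \<dots> (tb (alg c) 1 * y)" using y Q3.cg_mult_left by blast
    also note *
    finally show "sc c * y \<in> {x. Q3.cg (e x) x}" by simp
  qed (use e_prod in blast)
  then show ?thesis by simp
qed

end

section \<open>Descent of projectivity from Omega^(2) to Omega^(1)\<close>

context symder
begin

text \<open>The default 0 keeps all values in \<open>J\<close> and respects the relations that kill
  the variables outside the module.\<close>

definition \<theta> :: "('r \<times> 'r \<Rightarrow>\<^sub>0 'k) \<Rightarrow> ('r, 'k) tens" where
  "\<theta> v = (if abs_tens v \<in> J then abs_tens v else 0)"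

lemma \<theta>_mem: "\<theta> v \<in> J" by (simp add: \<theta>_def J.zero_mem)

lemma \<theta>_rep: "x \<in> J \<Longrightarrow> \<theta> (rep_tens x) = x" by (simp add: \<theta>_def)

lemma M_iff: "v \<in> IR_pre alg \<longleftrightarrow> abs_tens v \<in> J" by (simp add: J_def)

lemma deg2_eval_mono_mem:
  assumes "\<And>v. \<eta> v \<in> J" "mdeg m = 2" shows "mono_val \<eta> m \<in> Q 2"
proof -
  obtain u v where "m = Poly_Mapping.single u 1 + Poly_Mapping.single v 1"
    using assms(2) by (rule mdeg_2E)
  then show ?thesis using Q2_prod[OF assms(1) assms(1)] by (simp only: mono_val_add mono_val_single_1)
qed

text \<open>By \<open>e_Q2\<close> the map id - e kills I^2 modulo I^3, so it defines a linear map
  Omega^(1) -> Omega^(2) that splits the projection. Composing the coordinates of Omega^(2) with it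
  gives coordinates of Omega^(1).\<close>

lemma Omega1_from_Omega2:
  assumes s: "dual_basis (Q 3) s" shows "\<exists>s. dual_basis (Q 2) s"
proof -
  interpret deg2 "Q 3" "\<lambda>r. tb r 1" \<theta>
    using deg2_tb[OF Q3.ring_ideal_axioms K_subset_Q] .
  define \<Lambda> where "\<Lambda> = deg2_eval (\<lambda>r. tb r 1) \<theta>"
  define e where "e x = \<Lambda> (taylor2 x)" for x
  have L: "\<Lambda> f \<in> Q 3" if "f \<in> L" for f
    unfolding \<Lambda>_def
  proof (rule deg2_eval_sym_ideal[OF that[unfolded L_def]])
    fix w x assume "x \<in> IR_pow_pre alg 2"
    then have "abs_tens x \<in> Q 2" by (simp add: Q_def)
    then have "\<theta> x \<in> Q 2" by (simp add: \<theta>_def Q2.zero_mem)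
    then show "\<theta> w * \<theta> x \<in> Q 3" using Q3_prod \<theta>_mem by blast
  qed (simp_all add: M_iff \<theta>_def abs_simps J.add_mem abs_tact J.mult_mem Q3.zero_mem)
  interpret splitting alg e
  proof
    fix x y r
    show "Q3.cg (e (x + y)) (e x + e y)"
      using deg2_eval_add by (simp add: e_def \<Lambda>_def taylor2_add)
    show "Q3.cg (e (tb r 1 * x)) (tb r 1 * e x)"
      using deg2_eval_Pconst by (simp add: e_def \<Lambda>_def taylor2_act)
    show "e x \<in> Q 3" if "x \<in> Q 3" using L taylor2_Q3 that by (simp add: e_def)
  next
    fix u v assume J: "u \<in> J" "v \<in> J"
    have "\<Lambda> (taylor2 (u * v) - X u * X v) \<in> Q 3"
      using L taylor2_prod[OF J] by (simp add: L.cg_def)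
    then have "\<Lambda> (taylor2 (u * v)) - \<Lambda> (X u * X v) \<in> Q 3"
      unfolding \<Lambda>_def using Q3.cg_mem[OF deg2_eval_diff] by blast
    then have "Q3.cg (e (u * v)) (\<Lambda> (X u * X v))" by (simp add: e_def Q3.cg_def)
    also have "Q3.cg \<dots> (u * v)"
      using deg2_eval_Xvar_Xvar[of "rep_tens u" "rep_tens v"] J by (simp add: \<Lambda>_def X_def \<theta>_rep)
    finally show "Q3.cg (e (u * v)) (u * v)" .
  qed
  \<comment> \<open>Ensures that subtracting \<open>e y\<close> does not change the class of
    \<open>y\<close> in Omega^(1).\<close>
  have eQ2: "e x \<in> Q 2" for x
    unfolding e_def \<Lambda>_def deg2_eval_def
    by (rule Q2.psum_mem) (auto intro: Q2.zero_mem Q2.mult_mem deg2_eval_mono_mem \<theta>_mem)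
  then have eJ: "y - e y \<in> J" if "y \<in> J" for y using that Q2_subset_J J.diff_mem by blast
  have s_cong: "s x = s y" if "x \<in> J" "y \<in> J" "Q3.cg x y" for x y
    using dual_basis_cong[OF s] that by (simp add: Q3.cg_def)
  have "dual_basis (Q 2) (\<lambda>y. s (y - e y))"
    unfolding dual_basis_def
  proof (intro conjI ballI allI)
    fix y assume y: "y \<in> J"
    show "Poly_Mapping.keys (s (y - e y)) \<subseteq> J"
      using s eJ[OF y] by (auto simp: dual_basis_def)
    have "lin (s (y - e y)) - (y - e y) \<in> Q 2"
      using s eJ[OF y] Q3_subset_Q2 by (auto simp: dual_basis_def)
    from Q2.diff_mem[OF this eQ2[of y]] show "lin (s (y - e y)) - y \<in> Q 2" by simp
    fix r
    have "s (tb r 1 * y - e (tb r 1 * y)) = s (tb r 1 * (y - e y))"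
      using Q3.cg_diff[OF Q3.cg_refl e_tb] y
      by (intro s_cong eJ J.mult_mem) (simp_all add: right_diff_distrib)
    then show "s (tb r 1 * y - e (tb r 1 * y)) = free_rmul r (s (y - e y))"
      using s eJ[OF y] by (simp add: dual_basis_def)
  next
    fix x y assume xy: "x \<in> J" "y \<in> J"
    have "Q3.cg (x + y - e (x + y)) (x + y - (e x + e y))"
      by (intro Q3.cg_diff Q3.cg_refl e_add)
    then have "s (x + y - e (x + y)) = s ((x - e x) + (y - e y))"
      using xy by (intro s_cong eJ J.add_mem) (simp_all add: algebra_simps)
    then show "s (x + y - e (x + y)) = s (x - e x) + s (y - e y)"
      using s eJ xy by (simp add: dual_basis_def)
  next
    fix x assume "x \<in> Q 2"
    then have "x - e x \<in> Q 3"
      using Q3.cg_sym[OF e_Q2] by (simp add: Q3.cg_def)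
    then show "s (x - e x) = 0" using s by (simp add: dual_basis_def)
  qed
  then show ?thesis by blast
qed

section \<open>Ascent of projectivity from Omega^(1) to Omega^(2)\<close>

text \<open>A free module as the linear forms in its symmetric algebra, the polynomial ring on its
  index set.\<close>

definition \<iota> :: "('i \<Rightarrow>\<^sub>0 'r) \<Rightarrow> (('i \<Rightarrow>\<^sub>0 nat) \<Rightarrow>\<^sub>0 'r)" where
  "\<iota> = psum (\<lambda>i r. Pconst r * Xvar i)"

lemma \<iota>_add: "\<iota> (f + g) = \<iota> f + \<iota> g"
  unfolding \<iota>_def by (rule psum_add) (simp_all add: Pconst_add distrib_right)

lemma \<iota>_single: "\<iota> (Poly_Mapping.single i r) = Pconst r * Xvar i"
  unfolding \<iota>_def by (rule psum_single) simp

lemma \<iota>_0: "\<iota> 0 = 0" by (simp add: \<iota>_def)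

lemma \<iota>_free_rmul: "\<iota> (free_rmul r f) = Pconst r * \<iota> f"
  by (rule psum_ext[of "\<lambda>f. \<iota> (free_rmul r f)"])
     (simp_all add: \<iota>_add \<iota>_single free_rmul_add Pconst_mult distrib_left mult.assoc)

definition \<theta>T :: "('r, 'k) tens \<Rightarrow> ('r, 'k) tens" where
  "\<theta>T i = (if i \<in> J then i else 0)"

lemma \<theta>T_mem: "\<theta>T v \<in> J" by (simp add: \<theta>T_def J.zero_mem)

text \<open>Both sides are biadditive modulo \<open>K\<close>, which reduces the claim to two basis
  vectors. The supports must lie in \<open>J\<close> because \<open>\<theta>T\<close> is the
  identity only there.\<close>

lemma deg2_eval_\<iota>_\<iota>:
  assumes "Poly_Mapping.keys f \<subseteq> J" "Poly_Mapping.keys g \<subseteq> J"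
  shows "K.cg (deg2_eval (\<lambda>r. tb r 1) \<theta>T (\<iota> f * \<iota> g)) (lin f * lin g)"
proof -
  interpret deg2 K "\<lambda>r. tb r 1" \<theta>T
    using deg2_tb[OF K.ring_ideal_axioms] by simp
  let ?L = "deg2_eval (\<lambda>r. tb r 1) \<theta>T"
  have 0: "K.cg 0 (?L 0)" "lin 0 = 0" by (simp_all add: deg2_eval_def lin_def)
  have single: "K.cg (?L (\<iota> (Poly_Mapping.single i a) * \<iota> (Poly_Mapping.single j b)))
      (lin (Poly_Mapping.single i a) * lin (Poly_Mapping.single j b))"
    if "i \<in> J" "j \<in> J" for i j a b
  proof -
    have "K.cg (?L (Pconst (a * b) * (Xvar i * Xvar j))) (tb (a * b) 1 * ?L (Xvar i * Xvar j))"
      by (rule deg2_eval_Pconst)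
    also have "K.cg \<dots> (tb (a * b) 1 * (i * j))"
      using deg2_eval_Xvar_Xvar[of i j] that by (intro K.cg_mult_left) (simp add: \<theta>T_def)
    also have "tb (a * b) 1 = tb a 1 * (tb b 1 :: ('r, 'k) tens)"
      by (simp add: tb_mult)
    also have "tb a 1 * tb b 1 * (i * j) = (tb a 1 * i) * (tb b 1 * j)"
      by (simp add: mult_ac)
    also have "K.cg \<dots> (lin (Poly_Mapping.single i a) * lin (Poly_Mapping.single j b))"
      by (rule K.cg_sym[OF K.cg_mult[OF lin_single lin_single]])
    finally show ?thesis by (simp add: \<iota>_single Pconst_mult mult_ac)
  qed
  have left: "K.cg (?L (\<iota> (Poly_Mapping.single i a) * \<iota> g)) (lin (Poly_Mapping.single i a) * lin g)"
    if i: "i \<in> J" for i a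
    using assms(2)
  proof (induction g rule: poly_mapping_additive_induct_keys)
    case (add f g)
    let ?s = "Poly_Mapping.single i a"
    have "K.cg (?L (\<iota> ?s * \<iota> (f + g))) (?L (\<iota> ?s * \<iota> f) + ?L (\<iota> ?s * \<iota> g))"
      unfolding \<iota>_add distrib_left by (rule deg2_eval_add)
    also have "K.cg \<dots> (lin ?s * lin f + lin ?s * lin g)" by (rule K.cg_add[OF add(3,4)])
    also have "\<dots> = lin ?s * (lin f + lin g)" by (simp add: distrib_left)
    also have "K.cg \<dots> (lin ?s * lin (f + g))" by (rule K.cg_mult_left[OF K.cg_sym[OF lin_add]])
    finally show ?case .
  qed (simp_all add: \<iota>_0 0 single i K.cg_sym)
  show ?thesis
    using assms(1)
  proof (induction f rule: poly_mapping_additive_induct_keys)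
    case (add f h)
    have "K.cg (?L (\<iota> (f + h) * \<iota> g)) (?L (\<iota> f * \<iota> g) + ?L (\<iota> h * \<iota> g))"
      unfolding \<iota>_add distrib_right by (rule deg2_eval_add)
    also have "K.cg \<dots> (lin f * lin g + lin h * lin g)" by (rule K.cg_add[OF add(3,4)])
    also have "\<dots> = (lin f + lin h) * lin g" by (simp add: distrib_right)
    also have "K.cg \<dots> (lin (f + h) * lin g)" by (rule K.cg_mult[OF K.cg_sym[OF lin_add] K.cg_refl])
    finally show ?case .
  qed (simp_all add: \<iota>_0 0 left K.cg_sym)
qed

text \<open>A degree-two monomial in the variables indexed by elements of \<open>J\<close> becomes the generator of
  the free module indexed by the product of those elements.\<close>

definition \<tau> :: "((('r, 'k) tens \<Rightarrow>\<^sub>0 nat) \<Rightarrow>\<^sub>0 'r) \<Rightarrow> ('r, 'k) tens \<Rightarrow>\<^sub>0 'r" where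
  "\<tau> = psum (\<lambda>m r. if mdeg m = 2 then Poly_Mapping.single (mono_val \<theta>T m) r else 0)"

lemma \<tau>_add: "\<tau> (f + g) = \<tau> f + \<tau> g"
  unfolding \<tau>_def by (rule psum_add) (simp_all add: single_add)

lemma \<tau>_single:
  "\<tau> (Poly_Mapping.single m r) = (if mdeg m = 2 then Poly_Mapping.single (mono_val \<theta>T m) r else 0)"
  unfolding \<tau>_def by (rule psum_single) simp

lemma \<tau>_Pconst: "\<tau> (Pconst r * g) = free_rmul r (\<tau> g)"
  by (rule psum_ext[of "\<lambda>g. \<tau> (Pconst r * g)"])
     (simp_all add: distrib_left \<tau>_add free_rmul_add Pconst_def mult_single \<tau>_single)

lemma keys_\<tau>: "Poly_Mapping.keys (\<tau> g) \<subseteq> J"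
  unfolding \<tau>_def
  by (rule keys_psum) (use deg2_eval_mono_mem[of \<theta>T] \<theta>T_mem Q2_subset_J in auto)

text \<open>\<open>\<tau>\<close> may merge monomials with equal products, but it lifts the
  evaluation of quadratic polynomials through \<open>lin\<close>, and only that value is
  needed.\<close>

lemma lin_\<tau>: "K.cg (lin (\<tau> g)) (deg2_eval (\<lambda>r. tb r 1) \<theta>T g)"
proof -
  interpret deg2 K "\<lambda>r. tb r 1" \<theta>T
    using deg2_tb[OF K.ring_ideal_axioms] by simp
  show ?thesis
  proof (rule K.additive_ext[of "\<lambda>g. lin (\<tau> g)"])
    fix m a
    have "K.cg (lin (\<tau> (Poly_Mapping.single m a))) (if mdeg m = 2 then tb a 1 * mono_val \<theta>T m else 0)"
      using lin_single by (simp add: \<tau>_single) (simp add: lin_def)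
    then show "K.cg (lin (\<tau> (Poly_Mapping.single m a))) (deg2_eval (\<lambda>r. tb r 1) \<theta>T (Poly_Mapping.single m a))"
      using deg2_eval_single K.cg_sym K.cg_trans by meson
  qed (simp_all add: \<tau>_add lin_add deg2_eval_add)
qed

text \<open>The coordinates of \<open>y\<close> come in two groups: \<open>G y\<close> recovers
  \<open>e y\<close>, and \<open>s y\<close>, with every generator \<open>i\<close> replaced by
  \<open>i - e i\<close>, recovers \<open>y - e y\<close> modulo I^3.\<close>

lemma Omega2_from_Omega1:
  assumes s: "dual_basis (Q 2) s" shows "\<exists>s. dual_basis (Q 3) s"
proof -
  \<comment> \<open>The variable of an element becomes the linear form of its coordinates, so
    \<open>\<Lambda>\<close> is the quadratic part of the map S(Omega^(1)) -> S(F) induced by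
    \<open>s\<close>.\<close>
  define \<theta>P where "\<theta>P v = (if abs_tens v \<in> J then \<iota> (s (abs_tens v)) else 0)" for v
  define \<Lambda> where "\<Lambda> = deg2_eval Pconst \<theta>P"
  define G where "G y = \<tau> (\<Lambda> (taylor2 y))" for y
  define e where "e y = lin (G y)" for y
  have "deg2 {0} (Pconst :: 'r \<Rightarrow> ((('r, 'k) tens \<Rightarrow>\<^sub>0 nat) \<Rightarrow>\<^sub>0 'r))"
    by (intro deg2.intro ring_ideal_0 deg2_axioms.intro) (simp_all add: cg_0_eq Pconst_add Pconst_mult)
  then interpret P: deg2 "{0}" Pconst \<theta>P
    rewrites "add_subgroup.cg {0} = (=)"
    by (simp_all add: cg_0_eq)
  have s_add: "s (x + y) = s x + s y" and s_act: "s (tb r 1 * x) = free_rmul r (s x)"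
    and s_keys: "Poly_Mapping.keys (s x) \<subseteq> J" and s_lin: "Q2.cg (lin (s x)) x"
    if "x \<in> J" "y \<in> J" for x y r
    using s that by (auto simp: dual_basis_def Q2.cg_def)
  have s_Q2: "s x = 0" if "x \<in> Q 2" for x using s that by (simp add: dual_basis_def)
  \<comment> \<open>The target is a genuine polynomial ring: \<open>s\<close> is exactly linear on
    \<open>J\<close> and vanishes on \<open>Q 2\<close>, so the relations go to 0 rather than to a
    nonzero ideal.\<close>
  have L: "\<Lambda> f = 0" if "f \<in> L" for f
  proof -
    have "\<Lambda> f \<in> {0}"
      unfolding \<Lambda>_def
    proof (rule P.deg2_eval_sym_ideal[OF that[unfolded L_def]])
      fix w x assume "x \<in> IR_pow_pre alg 2"
      then have "abs_tens x \<in> Q 2" by (simp add: Q_def)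
      then show "\<theta>P w * \<theta>P x \<in> {0}" by (simp add: \<theta>P_def s_Q2 \<iota>_0)
    qed (simp_all add: M_iff \<theta>P_def abs_simps J.add_mem abs_tact J.mult_mem s_add s_act \<iota>_add \<iota>_free_rmul)
    then show ?thesis by simp
  qed
  have G_add: "G (x + y) = G x + G y" for x y
    by (simp add: G_def taylor2_add \<Lambda>_def P.deg2_eval_add \<tau>_add)
  have G_act: "G (tb r 1 * x) = free_rmul r (G x)" for r x
    by (simp add: G_def taylor2_act \<Lambda>_def P.deg2_eval_Pconst \<tau>_Pconst)
  have G_Q3: "G x = 0" if "x \<in> Q 3" for x
    using L taylor2_Q3 that by (simp add: G_def \<tau>_def)
  have G_keys: "Poly_Mapping.keys (G x) \<subseteq> J" for x by (simp add: G_def keys_\<tau>)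
  interpret splitting alg e
  proof
    fix x y r
    show "Q3.cg (e (x + y)) (e x + e y)"
      by (simp add: e_def G_add K_cg_Q3 lin_add)
    show "Q3.cg (e (tb r 1 * x)) (tb r 1 * e x)"
      by (simp add: e_def G_act K_cg_Q3 lin_free_rmul)
    show "e x \<in> Q 3" if "x \<in> Q 3"
      using that by (simp add: e_def G_Q3) (simp add: lin_def Q3.zero_mem)
  next
    fix u v assume J: "u \<in> J" "v \<in> J"
    have "\<Lambda> (taylor2 (u * v) - X u * X v) = 0"
      using L taylor2_prod[OF J] by (simp add: L.cg_def)
    then have "\<Lambda> (taylor2 (u * v)) = \<Lambda> (X u * X v)" by (simp add: \<Lambda>_def P.deg2_eval_diff)
    also have "\<dots> = \<iota> (s u) * \<iota> (s v)"
      using J by (simp add: \<Lambda>_def X_def P.deg2_eval_Xvar_Xvar \<theta>P_def)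
    finally have "e (u * v) = lin (\<tau> (\<iota> (s u) * \<iota> (s v)))" by (simp add: e_def G_def)
    also have "K.cg \<dots> (deg2_eval (\<lambda>r. tb r 1) \<theta>T (\<iota> (s u) * \<iota> (s v)))" by (rule lin_\<tau>)
    also have "K.cg \<dots> (lin (s u) * lin (s v))" using J by (intro deg2_eval_\<iota>_\<iota> s_keys)
    finally have "Q3.cg (e (u * v)) (lin (s u) * lin (s v))" by (rule K_cg_Q3)
    \<comment> \<open>The factors are replaced one at a time; each error is an element of
      \<open>J\<close> times one of \<open>Q 2\<close>, hence in \<open>Q 3\<close>.\<close>
    also have "Q3.cg \<dots> (u * lin (s v))"
      using Q3_prod[OF lin_mem[OF s_keys] s_lin[unfolded Q2.cg_def], of v v u u] J
      by (simp add: Q3.cg_def algebra_simps)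
    also have "Q3.cg \<dots> (u * v)"
      using Q3_prod[OF _ s_lin[unfolded Q2.cg_def], of u v v] J
      by (simp add: Q3.cg_def algebra_simps)
    finally show "Q3.cg (e (u * v)) (u * v)" .
  qed
  let ?sh = "rekey (\<lambda>i. i - e i)"
  have eJ: "e y \<in> J" for y unfolding e_def by (rule lin_mem[OF G_keys])
  have lin_sh: "Q3.cg (lin (?sh f)) (lin f - e (lin f))" for f
  proof (rule Q3.additive_ext[of "\<lambda>f. lin (?sh f)"])
    fix f g
    show "Q3.cg (lin (?sh (f + g))) (lin (?sh f) + lin (?sh g))"
      by (simp add: rekey_add K_cg_Q3 lin_add)
    have "Q3.cg (lin (f + g) - e (lin (f + g))) (lin f + lin g - (e (lin f) + e (lin g)))"
      by (rule Q3.cg_diff[OF K_cg_Q3[OF lin_add] Q3.cg_trans[OF e_cong[OF K_cg_Q3[OF lin_add]] e_add]])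
    then show "Q3.cg (lin (f + g) - e (lin (f + g))) (lin f - e (lin f) + (lin g - e (lin g)))"
      by (simp add: algebra_simps)
  next
    fix i a
    have l: "Q3.cg (tb a 1 * i) (lin (Poly_Mapping.single i a))"
      by (rule Q3.cg_sym[OF K_cg_Q3[OF lin_single]])
    have "Q3.cg (lin (?sh (Poly_Mapping.single i a))) (tb a 1 * (i - e i))"
      by (simp add: K_cg_Q3 lin_single)
    also have "\<dots> = tb a 1 * i - tb a 1 * e i" by (simp add: right_diff_distrib)
    also have "Q3.cg \<dots> (lin (Poly_Mapping.single i a) - e (lin (Poly_Mapping.single i a)))"
      by (rule Q3.cg_diff[OF l Q3.cg_trans[OF Q3.cg_sym[OF e_tb] e_cong[OF l]]])
    finally show "Q3.cg (lin (?sh (Poly_Mapping.single i a)))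
      (lin (Poly_Mapping.single i a) - e (lin (Poly_Mapping.single i a)))" .
  qed
  have "dual_basis (Q 3) (\<lambda>y. G y + ?sh (s y))"
    unfolding dual_basis_def
  proof (intro conjI ballI allI)
    fix y assume y: "y \<in> J"
    have "Poly_Mapping.keys (?sh (s y)) \<subseteq> J"
      using keys_rekey[of "\<lambda>i. i - e i" "s y"] s_keys[OF y y] eJ J.diff_mem by blast
    then show "Poly_Mapping.keys (G y + ?sh (s y)) \<subseteq> J"
      using keys_add[of "G y" "?sh (s y)"] G_keys[of y] by blast
    let ?l = "lin (s y)"
    have "Q3.cg (lin (G y + ?sh (s y))) (e y + lin (?sh (s y)))"
      unfolding e_def by (rule K_cg_Q3[OF lin_add])
    also have "Q3.cg \<dots> (e y + (?l - e ?l))" by (rule Q3.cg_add[OF Q3.cg_refl lin_sh])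
    \<comment> \<open>Since \<open>s\<close> is a dual basis modulo I^2 only, \<open>y - ?l\<close>
      is an arbitrary element of \<open>Q 2\<close>; there \<open>e\<close> acts as the identity
      modulo \<open>Q 3\<close>, which repairs the error.\<close>
    also have "\<dots> = (e y - e ?l) + ?l" by simp
    also have "Q3.cg \<dots> (e (y - ?l) + ?l)"
      by (rule Q3.cg_add[OF Q3.cg_sym[OF e_diff] Q3.cg_refl])
    also have "Q3.cg \<dots> ((y - ?l) + ?l)"
      using Q2.cg_sym[OF s_lin[OF y y]]
      by (intro Q3.cg_add e_Q2 Q3.cg_refl) (simp add: Q2.cg_def)
    finally show "lin (G y + ?sh (s y)) - y \<in> Q 3" by (simp add: Q3.cg_def)
    show "G (tb r 1 * y) + ?sh (s (tb r 1 * y)) = free_rmul r (G y + ?sh (s y))" for r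
      using y by (simp add: G_act s_act rekey_free_rmul free_rmul_add)
  next
    fix x y assume "x \<in> J" "y \<in> J"
    then show "G (x + y) + ?sh (s (x + y)) = G x + ?sh (s x) + (G y + ?sh (s y))"
      by (simp add: G_add s_add rekey_add)
  next
    fix x assume "x \<in> Q 3"
    then show "G x + ?sh (s x) = 0" using Q3_subset_Q2 by (auto simp: G_Q3 s_Q2)
  qed
  then show ?thesis by blast
qed

end

theorem theorem3p9:
  fixes alg :: "'k::{alg_closed_field, field_char_0} \<Rightarrow> 'r::comm_ring_1"
  assumes "affine_k_algebra alg"
    and "\<exists>D. symmetric_derivation alg D"
  shows "Omega_projective alg 1 \<longleftrightarrow> Omega_projective alg 2"
proof -
  obtain D where "symmetric_derivation alg D" using assms(2) by blast
  \<comment> \<open>Characteristic zero supplies the element \<open>half\<close> of the ground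
    field.\<close>
  then interpret symder alg D "1 / 2"
    using assms(1) by unfold_locales (simp_all add: affine_k_algebra_def)
  have "Suc 1 = 2" "Suc 2 = 3" by simp_all
  then show ?thesis
    unfolding Omega_projective_iff using Omega1_from_Omega2 Omega2_from_Omega1 by metis
qed

end
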